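(* Let $G$ be a compact group and $n\ge1$. Then $d^{(n+1)}(G)\le\frac{1}{2^n}\big(2^n-1+d(G/Z_n(G))\big)$.
   Context: For a compact group $X$, $\mu_X$ denotes its normalized Haar measure and $\mu_X^m$ the product measure on $X^m$. $Z_n(G)$ is the $n$-th term of the upper central series of $G$ ($Z_0(G)=1$, $Z_{i+1}(G)/Z_i(G)=Z(G/Z_i(G))$); it is closed and normal. Commutators: $[x,y]=x^{-1}y^{-1}xy$, $[x_1,\dots,x_{k+1}]=[[x_1,\dots,x_k],x_{k+1}]$. For a compact group $X$ and $m\ge1$, $d^{(m)}(X)=\mu_X^{m+1}(\{(x_1,\dots,x_{m+1})\in X^{m+1}: [x_1,\dots,x_{m+1}]=1\})$, and $d(X)=d^{(1)}(X)$. *)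

theory Defs
  imports "HOL-Analysis.Analysis" "HOL-Algebra.Algebra"
begin

definition compact_group :: "('a, 'b) monoid_scheme \<Rightarrow> 'a topology \<Rightarrow> bool" where
  "compact_group G T \<longleftrightarrow> group G \<and> topspace T = carrier G \<and> compact_space T \<and> Hausdorff_space T
     \<and> continuous_map (prod_topology T T) T (\<lambda>(x, y). x \<otimes>\<^bsub>G\<^esub> y)
     \<and> continuous_map T T (\<lambda>x. inv\<^bsub>G\<^esub> x)"

definition borel_sets_of :: "'a topology \<Rightarrow> 'a set set" where
  "borel_sets_of T = sigma_sets (topspace T) {U. openin T U}"

definition is_haar :: "('a, 'b) monoid_scheme \<Rightarrow> 'a topology \<Rightarrow> 'a measure \<Rightarrow> bool" where
  "is_haar G T \<mu> \<longleftrightarrow> emeasure \<mu> (space \<mu>) = 1 \<and> space \<mu> = topspace T \<and> sets \<mu> = borel_sets_of T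
     \<and> (\<forall>g\<in>carrier G. \<forall>A\<in>sets \<mu>. emeasure \<mu> ((\<lambda>x. g \<otimes>\<^bsub>G\<^esub> x) ` A) = emeasure \<mu> A)
     \<and> (\<forall>A\<in>sets \<mu>. emeasure \<mu> A = (INF U\<in>{U. openin T U \<and> A \<subseteq> U}. emeasure \<mu> U))
     \<and> (\<forall>U. openin T U \<longrightarrow> emeasure \<mu> U = (SUP K\<in>{K. compactin T K \<and> K \<subseteq> U}. emeasure \<mu> K))"

definition haar_measure :: "('a, 'b) monoid_scheme \<Rightarrow> 'a topology \<Rightarrow> 'a measure" where
  "haar_measure G T = (THE \<mu>. is_haar G T \<mu>)"

definition commutator :: "('a, 'b) monoid_scheme \<Rightarrow> 'a \<Rightarrow> 'a \<Rightarrow> 'a" where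
  "commutator G x y = inv\<^bsub>G\<^esub> x \<otimes>\<^bsub>G\<^esub> inv\<^bsub>G\<^esub> y \<otimes>\<^bsub>G\<^esub> x \<otimes>\<^bsub>G\<^esub> y"

fun iter_comm :: "('a, 'b) monoid_scheme \<Rightarrow> (nat \<Rightarrow> 'a) \<Rightarrow> nat \<Rightarrow> 'a" where
  "iter_comm G x 0 = x 0"
| "iter_comm G x (Suc k) = commutator G (iter_comm G x k) (x (Suc k))"

definition group_center :: "('a, 'b) monoid_scheme \<Rightarrow> 'a set" where
  "group_center G = {x \<in> carrier G. \<forall>y\<in>carrier G. x \<otimes>\<^bsub>G\<^esub> y = y \<otimes>\<^bsub>G\<^esub> x}"

fun upper_central :: "('a, 'b) monoid_scheme \<Rightarrow> nat \<Rightarrow> 'a set" where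
  "upper_central G 0 = {\<one>\<^bsub>G\<^esub>}"
| "upper_central G (Suc i) =
     {x \<in> carrier G. upper_central G i #>\<^bsub>G\<^esub> x \<in> group_center (G Mod upper_central G i)}"

definition quotient_top :: "('a, 'b) monoid_scheme \<Rightarrow> 'a topology \<Rightarrow> 'a set \<Rightarrow> 'a set topology" where
  "quotient_top G T N = topology (\<lambda>U. U \<subseteq> rcosets\<^bsub>G\<^esub> N \<and> openin T (\<Union>U))"

definition comm_degree :: "nat \<Rightarrow> ('a, 'b) monoid_scheme \<Rightarrow> 'a topology \<Rightarrow> real" where
  "comm_degree m G T =
     measure (haar_measure (product_group {..m} (\<lambda>_. G)) (product_topology (\<lambda>_. T) {..m}))
       {x \<in> (\<Pi>\<^sub>E i\<in>{..m}. carrier G). iter_comm G x m = \<one>\<^bsub>G\<^esub>}"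

end

theory Submission
  imports Defs
begin

text \<open>
  Put \<open>E\<^sub>k = {x. [x\<^sub>0, \<dots>, x\<^sub>k] \<in> Z\<^sub>n\<^sub>+\<^sub>1\<^sub>-\<^sub>k}\<close>. If \<open>a = [x\<^sub>0, \<dots>, x\<^sub>k]\<close> is not in \<open>Z\<^sub>j\<^sub>+\<^sub>1\<close>, then the
  elements \<open>y\<close> with \<open>[a, y] \<in> Z\<^sub>j\<close> form a proper subgroup, so each step from \<open>k\<close> to \<open>k + 1\<close> at most
  halves the measure of the complement of \<open>E\<^sub>k\<close>; moreover \<open>E\<^sub>1\<close> has measure \<open>d(G/Z\<^sub>n)\<close> because Haar
  measure is pushed forward to Haar measure.

  The Borel sets of a power of \<open>G\<close> need not be generated by boxes, so Fubini is not available. Instead,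
  the complement of \<open>E\<^sub>k\<close> is covered by open sets on which a single \<open>g\<close> with \<open>[a, g] \<notin> Z\<^sub>j\<close> works;
  translating coordinate \<open>k + 1\<close> by \<open>g\<close> there moves the bad set off itself, and inner regularity
  reduces to finitely many of these sets.

  Existence and uniqueness of Haar measure both come from one counting fact: if \<open>A\<close> is a finite set of
  least cardinality with \<open>A V = G\<close>, then \<open>|gA \<inter> K| \<le> |hA \<inter> U|\<close> for all \<open>g\<close>, \<open>h\<close> whenever
  \<open>K V V\<inverse> \<subseteq> U\<close>.
\<close>

section \<open>Borel sets of a topology\<close>

lemma sigma_algebra_borel_sets_of: "sigma_algebra (topspace T) (borel_sets_of T)"
  unfolding borel_sets_of_def by (intro sigma_algebra_sigma_sets) (auto dest: openin_subset)

lemma borel_sets_of_subset: "A \<in> borel_sets_of T \<Longrightarrow> A \<subseteq> topspace T"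
  unfolding borel_sets_of_def by (rule sigma_sets_into_sp) (auto dest: openin_subset)

lemma borel_sets_of_open: "openin T U \<Longrightarrow> U \<in> borel_sets_of T"
  unfolding borel_sets_of_def by (auto intro: sigma_sets.Basic)

lemma borel_sets_of_closed:
  assumes K: "closedin T K" shows "K \<in> borel_sets_of T"
proof -
  have "topspace T - (topspace T - K) \<in> borel_sets_of T"
    using K unfolding borel_sets_of_def by (intro sigma_sets.Compl sigma_sets.Basic) auto
  then show ?thesis using closedin_subset[OF K] by (simp add: double_diff)
qed

lemma borel_sets_of_vimage:
  assumes f: "continuous_map S T f" and A: "A \<in> borel_sets_of T"
  shows "f -` A \<inter> topspace S \<in> borel_sets_of S"
  using A unfolding borel_sets_of_def[of T]
proof (induction rule: sigma_sets.induct)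
  case (Basic a)
  then have "openin S {x \<in> topspace S. f x \<in> a}" using f by (auto simp: continuous_map_def)
  also have "{x \<in> topspace S. f x \<in> a} = f -` a \<inter> topspace S" by auto
  finally show ?case by (rule borel_sets_of_open)
next
  case Empty show ?case by (simp add: borel_sets_of_open)
next
  case (Compl a)
  have "topspace S - (f -` a \<inter> topspace S) \<in> borel_sets_of S"
    using Compl.IH unfolding borel_sets_of_def by (rule sigma_sets.Compl)
  also have "topspace S - (f -` a \<inter> topspace S) = f -` (topspace T - a) \<inter> topspace S"
    using f by (auto simp: continuous_map_def)
  finally show ?case .
next
  case (Union a)
  have "(\<Union>i. f -` a i \<inter> topspace S) \<in> borel_sets_of S"
    using Union.IH unfolding borel_sets_of_def by (rule sigma_sets.Union)
  also have "(\<Union>i. f -` a i \<inter> topspace S) = f -` (\<Union>(range a)) \<inter> topspace S" by auto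
  finally show ?case .
qed

text \<open>The target is written with \<open>sigma\<close> so that \<open>distr\<close> can later
  push Haar measure forward onto the Borel sets of an arbitrary topology.\<close>

lemma measurable_continuous_map:
  assumes f: "continuous_map S T f" and M: "space M = topspace S" "sets M = borel_sets_of S"
  shows "f \<in> measurable M (sigma (topspace T) (borel_sets_of T))"
proof (rule measurable_measure_of)
  show "borel_sets_of T \<subseteq> Pow (topspace T)" using borel_sets_of_subset by blast
  show "f \<in> space M \<rightarrow> topspace T" using f by (auto simp: M continuous_map_def)
  show "f -` A \<inter> space M \<in> sets M" if "A \<in> borel_sets_of T" for A
    using borel_sets_of_vimage[OF f that] by (simp add: M)
qed

section \<open>Regular measures from finitely additive ones\<close>

text \<open>\<open>l\<close> is additive on all subsets and need not respect the topology; a limit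
  of normalized counting measures is of this kind. The regularization approximates open sets by
  closed sets from inside, then arbitrary sets by open sets from outside.\<close>

locale finitely_additive_compact =
  fixes T :: "'a topology" and l :: "'a set \<Rightarrow> ennreal"
  assumes cpt: "compact_space T" and haus: "Hausdorff_space T"
    and l_empty: "l {} = 0"
    and l_add: "\<And>A B. A \<inter> B = {} \<Longrightarrow> l (A \<union> B) = l A + l B"
begin

lemma l_mono: "A \<subseteq> B \<Longrightarrow> l A \<le> l B"
  using l_add[of A "B - A"] by (simp add: Un_absorb1)

lemma l_subadd: "l (A \<union> B) \<le> l A + l B"
  using l_add[of A "B - A"] l_mono[of "B - A" B] by (simp add: add_left_mono)

text \<open>Inner regularization of \<open>l\<close>. It is bounded by \<open>l U\<close> but may
  differ from it.\<close>

definition open_content :: "'a set \<Rightarrow> ennreal" where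
  "open_content U = (SUP K\<in>{K. closedin T K \<and> K \<subseteq> U}. l K)"

definition outer_content :: "'a set \<Rightarrow> ennreal" where
  "outer_content A = (INF U\<in>{U. openin T U \<and> A \<subseteq> U}. open_content U)"

lemma open_content_upper: "closedin T K \<Longrightarrow> K \<subseteq> U \<Longrightarrow> l K \<le> open_content U"
  unfolding open_content_def by (auto intro: SUP_upper)

lemma open_content_mono: "U \<subseteq> V \<Longrightarrow> open_content U \<le> open_content V"
  unfolding open_content_def by (intro SUP_subset_mono) auto

lemma outer_content_lower: "openin T U \<Longrightarrow> A \<subseteq> U \<Longrightarrow> outer_content A \<le> open_content U"
  unfolding outer_content_def by (auto intro: INF_lower)

lemma outer_content_open: "openin T U \<Longrightarrow> outer_content U = open_content U"
  unfolding outer_content_def by (intro antisym INF_lower INF_greatest) (auto intro: open_content_mono)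

lemma outer_content_mono: "A \<subseteq> B \<Longrightarrow> outer_content A \<le> outer_content B"
  unfolding outer_content_def by (intro INF_superset_mono) auto

lemma open_content_empty: "open_content {} = 0"
  by (simp add: open_content_def l_empty subset_empty cong: conj_cong SUP_cong_simp)

lemma normal_space_T: "normal_space T"
  using cpt haus compact_Hausdorff_or_regular_imp_normal_space by blast

text \<open>For closed \<open>K\<close> inside the union, normality separates \<open>K - U\<close>
  and \<open>K - V\<close> by disjoint open sets \<open>A\<close> and \<open>B\<close>. Then
  \<open>K - A\<close> and \<open>K - B\<close> are closed, cover \<open>K\<close>, and lie in
  \<open>U\<close> and \<open>V\<close> respectively.\<close>

lemma open_content_Un:
  assumes U: "openin T U" and V: "openin T V"
  shows "open_content (U \<union> V) \<le> open_content U + open_content V"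
  unfolding open_content_def[of "U \<union> V"]
proof (rule SUP_least, clarify)
  fix K assume K: "closedin T K" "K \<subseteq> U \<union> V"
  have "closedin T (K - U)" "closedin T (K - V)" "disjnt (K - U) (K - V)"
    using K U V by (auto simp: disjnt_def)
  then obtain A B where AB: "openin T A" "openin T B" "K - U \<subseteq> A" "K - V \<subseteq> B" "disjnt A B"
    using normal_space_T unfolding normal_space_def by metis
  have "l K \<le> l ((K - A) \<union> (K - B))"
    using AB by (intro l_mono) (auto simp: disjnt_def)
  also have "\<dots> \<le> l (K - A) + l (K - B)" by (rule l_subadd)
  also have "\<dots> \<le> open_content U + open_content V"
    using AB K by (intro add_mono open_content_upper) auto
  finally show "l K \<le> open_content U + open_content V" .
qed

lemma open_content_UN_finite:
  fixes U :: "nat \<Rightarrow> 'a set"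
  shows "(\<And>i. i < n \<Longrightarrow> openin T (U i)) \<Longrightarrow> open_content (\<Union>i<n. U i) \<le> (\<Sum>i<n. open_content (U i))"
proof (induction n)
  case 0 then show ?case by (simp add: open_content_empty)
next
  case (Suc n)
  have "open_content (\<Union>i<Suc n. U i) = open_content ((\<Union>i<n. U i) \<union> U n)"
    by (simp add: lessThan_Suc Un_commute)
  also have "\<dots> \<le> open_content (\<Union>i<n. U i) + open_content (U n)"
    using Suc.prems by (intro open_content_Un) auto
  also have "\<dots> \<le> (\<Sum>i<n. open_content (U i)) + open_content (U n)"
    using Suc by (intro add_mono) auto
  finally show ?case by simp
qed

text \<open>A closed \<open>K\<close> inside the union is compact, so an initial segment of the
  \<open>U i\<close> already covers it and finite subadditivity applies.\<close>

lemma open_content_UN: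
  fixes U :: "nat \<Rightarrow> 'a set"
  assumes U: "\<And>i. openin T (U i)"
  shows "open_content (\<Union>i. U i) \<le> suminf (\<lambda>i. open_content (U i))"
  unfolding open_content_def[of "\<Union>i. U i"]
proof (rule SUP_least, clarify)
  fix K assume K: "closedin T K" "K \<subseteq> (\<Union>i. U i)"
  then have "compactin T K" using cpt closedin_compact_space by blast
  then obtain \<F> where F: "finite \<F>" "\<F> \<subseteq> range U" "K \<subseteq> \<Union>\<F>"
    using K U unfolding compactin_def by (metis (no_types, lifting) image_iff)
  then obtain I where I: "finite I" "\<F> = U ` I" by (meson finite_subset_image)
  obtain n where n: "I \<subseteq> {..<n}" using I finite_nat_iff_bounded by blast
  have "l K \<le> open_content (\<Union>i<n. U i)"
    using K F I n by (intro open_content_upper) blast+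
  also have "\<dots> \<le> (\<Sum>i<n. open_content (U i))" using U by (intro open_content_UN_finite)
  also have "\<dots> \<le> suminf (\<lambda>i. open_content (U i))" by (intro sum_le_suminf) auto
  finally show "l K \<le> suminf (\<lambda>i. open_content (U i))" .
qed

lemma outer_content_UN:
  fixes A :: "nat \<Rightarrow> 'a set"
  assumes A: "\<And>i. A i \<subseteq> topspace T" and fin: "l (topspace T) < \<infinity>"
  shows "outer_content (\<Union>i. A i) \<le> suminf (\<lambda>i. outer_content (A i))"
proof (rule ennreal_le_epsilon)
  fix e :: real assume e: "0 < e"
  have fin': "outer_content (A i) < \<infinity>" for i
  proof -
    have "outer_content (A i) \<le> open_content (topspace T)"
      using A by (intro outer_content_lower) auto
    also have "\<dots> \<le> l (topspace T)"
      unfolding open_content_def by (intro SUP_least) (auto intro: l_mono)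
    finally show ?thesis using fin by (simp add: less_le_trans order_le_less_trans)
  qed
  have "\<exists>U. openin T U \<and> A i \<subseteq> U \<and> open_content U \<le> outer_content (A i) + ennreal (e * (1/2)^Suc i)" for i
  proof -
    \<comment> \<open>Finiteness makes this inequality strict, so the infimum is undercut by some
      open set. The errors are chosen to sum to \<open>e\<close>.\<close>
    have "outer_content (A i) < outer_content (A i) + ennreal (e * (1/2)^Suc i)"
      using fin'[of i] e by (cases "outer_content (A i)") (auto simp: ennreal_plus[symmetric] ennreal_less_iff simp del: ennreal_plus)
    then obtain U where "openin T U" "A i \<subseteq> U" "open_content U < outer_content (A i) + ennreal (e * (1/2)^Suc i)"
      unfolding outer_content_def INF_less_iff by auto
    then show ?thesis using less_imp_le by blast
  qed
  then obtain U where U: "\<And>i. openin T (U i)" "\<And>i. A i \<subseteq> U i"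
    "\<And>i. open_content (U i) \<le> outer_content (A i) + ennreal (e * (1/2)^Suc i)"
    by metis
  have s: "(\<lambda>i. e * (1/2)^Suc i) sums (e * 1)"
    by (intro sums_mult power_half_series)
  have "outer_content (\<Union>i. A i) \<le> open_content (\<Union>i. U i)"
    using U by (intro outer_content_lower) auto
  also have "\<dots> \<le> suminf (\<lambda>i. open_content (U i))" using U by (intro open_content_UN)
  also have "\<dots> \<le> suminf (\<lambda>i. outer_content (A i) + ennreal (e * (1/2)^Suc i))"
    using U by (intro suminf_le) auto
  also have "\<dots> = suminf (\<lambda>i. outer_content (A i)) + suminf (\<lambda>i. ennreal (e * (1/2)^Suc i))"
    by (intro suminf_add[symmetric]) auto
  also have "suminf (\<lambda>i. ennreal (e * (1/2)^Suc i)) = ennreal (suminf (\<lambda>i. e * (1/2)^Suc i))"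
    using s e by (intro suminf_ennreal2) (auto simp: sums_iff)
  also have "\<dots> = ennreal e" using s by (simp add: sums_iff)
  finally show "outer_content (\<Union>i. A i) \<le> suminf (\<lambda>i. outer_content (A i)) + ennreal e" .
qed

text \<open>This is the nontrivial half of the Caratheodory condition for open \<open>U\<close>.
  Given open \<open>W\<close> around \<open>A\<close>, exhaust \<open>W \<inter> U\<close> by closed
  \<open>K\<close>, then \<open>W - K\<close> by closed \<open>L\<close>. The sets are disjoint and
  their union is a closed subset of \<open>W\<close>, so \<open>l K + l L\<close> is at most
  \<open>open_content W\<close>.\<close>

lemma outer_content_split:
  assumes U: "openin T U"
  shows "outer_content (A \<inter> U) + outer_content (A - U) \<le> outer_content A"
  unfolding outer_content_def[of A]
proof (rule INF_greatest, clarify)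
  fix W assume W: "openin T W" "A \<subseteq> W"
  have WU: "openin T (W \<inter> U)" using W U by auto
  have *: "l K + outer_content (A - U) \<le> open_content W" if K: "closedin T K" "K \<subseteq> W \<inter> U" for K
  proof -
    have WK: "openin T (W - K)" using W K by auto
    have ne: "{L. closedin T L \<and> L \<subseteq> W - K} \<noteq> {}" by (auto intro: exI[of _ "{}"])
    have "l K + outer_content (A - U) \<le> l K + open_content (W - K)"
      using WK K W by (intro add_left_mono outer_content_lower) auto
    also have "\<dots> = (SUP L\<in>{L. closedin T L \<and> L \<subseteq> W - K}. l K + l L)"
      unfolding open_content_def by (rule ennreal_SUP_add_right[OF ne])
    also have "\<dots> \<le> open_content W"
    proof (rule SUP_least, clarify)
      fix L assume L: "closedin T L" "L \<subseteq> W - K"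
      have "l K + l L = l (K \<union> L)" using L by (intro l_add[symmetric]) auto
      also have "\<dots> \<le> open_content W" using K L by (intro open_content_upper) auto
      finally show "l K + l L \<le> open_content W" .
    qed
    finally show ?thesis .
  qed
  have ne: "{K. closedin T K \<and> K \<subseteq> W \<inter> U} \<noteq> {}" by (auto intro: exI[of _ "{}"])
  have "outer_content (A \<inter> U) + outer_content (A - U) \<le> open_content (W \<inter> U) + outer_content (A - U)"
    using WU W by (intro add_right_mono outer_content_lower) auto
  also have "\<dots> = (SUP K\<in>{K. closedin T K \<and> K \<subseteq> W \<inter> U}. l K + outer_content (A - U))"
    unfolding open_content_def by (rule ennreal_SUP_add_left[symmetric, OF ne]) 
  also have "\<dots> \<le> open_content W" using * by (auto intro: SUP_least)
  finally show "outer_content (A \<inter> U) + outer_content (A - U) \<le> open_content W" .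
qed

definition content_measure :: "'a measure" where
  "content_measure = measure_of (topspace T) (borel_sets_of T) outer_content"

lemma space_content_measure: "space content_measure = topspace T"
  unfolding content_measure_def by (rule space_measure_of) (auto dest: borel_sets_of_subset)

lemma sets_content_measure: "sets content_measure = borel_sets_of T"
  unfolding content_measure_def
  by (rule sigma_algebra.sets_measure_of_eq[OF sigma_algebra_borel_sets_of])

text \<open>By Caratheodory, \<open>outer_content\<close> is a measure on its lambda system. That
  system contains every open set, hence every Borel set.\<close>

lemma emeasure_content_measure:
  assumes fin: "l (topspace T) < \<infinity>" and A: "A \<in> borel_sets_of T"
  shows "emeasure content_measure A = outer_content A"
proof -
  let ?X = "topspace T"
  interpret P: sigma_algebra ?X "Pow ?X" by (rule sigma_algebra_Pow)
  have oe: "outer_content {} = 0" by (simp add: outer_content_open open_content_empty)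
  have "countably_subadditive (Pow ?X) outer_content"
    unfolding countably_subadditive_def using outer_content_UN[OF _ fin] by (auto simp: image_subset_iff)
  then have oms: "outer_measure_space (Pow ?X) outer_content"
    unfolding outer_measure_space_def positive_def increasing_def
    by (auto simp: oe outer_content_mono)
  have L: "measure_space ?X (lambda_system ?X (Pow ?X) outer_content) outer_content"
    by (rule P.caratheodory_lemma[OF oms])
  then have sL: "sigma_algebra ?X (lambda_system ?X (Pow ?X) outer_content)"
    by (simp add: measure_space_def)
  have "U \<in> lambda_system ?X (Pow ?X) outer_content" if U: "openin T U" for U
    unfolding P.lambda_system_eq
  proof (clarify, intro conjI ballI)
    show "U \<in> Pow ?X" using U openin_subset by auto
    fix A assume A: "A \<in> Pow ?X"
    have "outer_content ((A \<inter> U) \<union> (A - U)) \<le> outer_content (A \<inter> U) + outer_content (A - U)"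
      using oms A \<open>U \<in> Pow ?X\<close> unfolding outer_measure_space_def
      by (intro subadditiveD[OF P.countably_subadditive_subadditive]) auto
    then have "outer_content A \<le> outer_content (A \<inter> U) + outer_content (A - U)"
      by (simp add: Int_Diff_Un)
    then show "outer_content (A \<inter> U) + outer_content (A - U) = outer_content A"
      using outer_content_split[OF U, of A] by (rule antisym[rotated])
  qed
  then have sub: "borel_sets_of T \<subseteq> lambda_system ?X (Pow ?X) outer_content"
    unfolding borel_sets_of_def by (intro sigma_algebra.sigma_sets_subset[OF sL]) auto
  have ms: "measure_space ?X (borel_sets_of T) outer_content"
    using measure_down[OF L sigma_algebra_borel_sets_of sub] .
  then show ?thesis
    using A unfolding measure_space_def content_measure_def by (intro emeasure_measure_of_sigma) auto
qed

lemma content_measure_outer_regular: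
  assumes fin: "l (topspace T) < \<infinity>" and A: "A \<in> borel_sets_of T"
  shows "emeasure content_measure A = (INF U\<in>{U. openin T U \<and> A \<subseteq> U}. emeasure content_measure U)"
proof -
  have "emeasure content_measure U = open_content U" if "openin T U" for U
    using that by (simp add: emeasure_content_measure[OF fin] borel_sets_of_def sigma_sets.Basic outer_content_open)
  then show ?thesis
    unfolding emeasure_content_measure[OF assms] outer_content_def by (intro INF_cong) auto
qed

text \<open>For closed \<open>K\<close>, every open set around \<open>K\<close> has
  \<open>open_content\<close> at least \<open>l K\<close>, so \<open>l K\<close> is at most the
  measure of \<open>K\<close>. This inequality suffices to dominate the supremum defining
  \<open>open_content U\<close> term by term.\<close>

lemma content_measure_inner_regular:
  assumes fin: "l (topspace T) < \<infinity>" and U: "openin T U"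
  shows "emeasure content_measure U = (SUP K\<in>{K. compactin T K \<and> K \<subseteq> U}. emeasure content_measure K)"
proof (rule antisym)
  have b: "A \<in> borel_sets_of T" if "openin T A \<or> closedin T A" for A
    using that by (auto intro: borel_sets_of_open borel_sets_of_closed)
  have "l K \<le> emeasure content_measure K" if K: "closedin T K" for K
    unfolding emeasure_content_measure[OF fin b[OF disjI2[OF K]]] outer_content_def
    using K by (intro INF_greatest) (auto intro: open_content_upper)
  then show "emeasure content_measure U \<le> (SUP K\<in>{K. compactin T K \<and> K \<subseteq> U}. emeasure content_measure K)"
    unfolding emeasure_content_measure[OF fin b[OF disjI1[OF U]]] outer_content_open[OF U] open_content_def
    using cpt by (intro SUP_mono) (auto intro: closedin_compact_space)
  show "(SUP K\<in>{K. compactin T K \<and> K \<subseteq> U}. emeasure content_measure K) \<le> emeasure content_measure U"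
    using U by (intro SUP_least emeasure_mono) (auto simp: sets_content_measure b haus compactin_imp_closedin)
qed

end

section \<open>Haar measure on compact groups\<close>

text \<open>Otherwise trading \<open>I\<close> for the members of \<open>B\<close> that meet it would give a smaller cover.\<close>

lemma minimal_cover_exchange:
  assumes "finite A" "finite B" and B: "\<Omega> \<subseteq> \<Union>(R ` B)" and AX: "\<Omega> \<subseteq> \<Union>(R ` A)" "\<Union>(R ` A) \<subseteq> \<Omega>"
    and min: "\<And>C. finite C \<Longrightarrow> C \<subseteq> A \<union> B \<Longrightarrow> \<Omega> \<subseteq> \<Union>(R ` C) \<Longrightarrow> card A \<le> card C"
    and I: "I \<subseteq> A"
  shows "card I \<le> card {b \<in> B. \<exists>a\<in>I. R a \<inter> R b \<noteq> {}}"
proof -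
  let ?J = "{b \<in> B. \<exists>a\<in>I. R a \<inter> R b \<noteq> {}}"
  have fin: "finite I" "finite ?J" using assms finite_subset by auto
  have "card A \<le> card ((A - I) \<union> ?J)"
  proof (rule min)
    show "\<Omega> \<subseteq> \<Union>(R ` ((A - I) \<union> ?J))"
    proof
      fix x assume "x \<in> \<Omega>"
      then obtain a b where ab: "a \<in> A" "b \<in> B" "x \<in> R a" "x \<in> R b" using B AX by blast
      show "x \<in> \<Union>(R ` ((A - I) \<union> ?J))"
      proof (cases "a \<in> I")
        case True
        then have "b \<in> ?J" using ab by blast
        then show ?thesis using ab by blast
      qed (use ab in blast)
    qed
  qed (use assms fin in auto)
  also have "\<dots> \<le> card (A - I) + card ?J" by (rule card_Un_le)
  also have "card (A - I) = card A - card I" using I fin by (simp add: card_Diff_subset)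
  finally show ?thesis using card_mono[OF \<open>finite A\<close> I] by linarith
qed

section \<open>Translations, uniform neighbourhoods and nets in a compact group\<close>

locale compact_topological_group =
  fixes G :: "('a, 'b) monoid_scheme" (structure) and T :: "'a topology"
  assumes compact_group: "compact_group G T"
begin

sublocale group G using compact_group by (simp add: compact_group_def)

lemma topspace_eq [simp]: "topspace T = carrier G"
  using compact_group by (simp add: compact_group_def)

lemma openin_carrier [simp]: "openin T (carrier G)" and closedin_carrier [simp]: "closedin T (carrier G)"
  using openin_topspace[of T] closedin_topspace[of T] by simp_all

lemma cpt: "compact_space T" and haus: "Hausdorff_space T"
  using compact_group by (auto simp: compact_group_def)

lemma compactin_iff_closedin: "compactin T K \<longleftrightarrow> closedin T K"
  using cpt haus closedin_compact_space compactin_imp_closedin by blast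

lemma continuous_mult:
  assumes "continuous_map \<Omega> T f" "continuous_map \<Omega> T g"
  shows "continuous_map \<Omega> T (\<lambda>x. f x \<otimes> g x)"
proof -
  have "continuous_map \<Omega> T ((\<lambda>(x, y). x \<otimes> y) \<circ> (\<lambda>x. (f x, g x)))"
    using compact_group assms
    by (intro continuous_map_compose[where X' = "prod_topology T T"]) (auto simp: compact_group_def continuous_map_pairwise comp_def)
  then show ?thesis by (simp add: comp_def)
qed

lemma continuous_inv:
  assumes "continuous_map \<Omega> T f"
  shows "continuous_map \<Omega> T (\<lambda>x. inv f x)"
  using continuous_map_compose[OF assms, of T "\<lambda>x. inv x"] compact_group
  by (simp add: compact_group_def comp_def)

lemma homeomorphic_left_translation:
  assumes g: "g \<in> carrier G"
  shows "homeomorphic_map T T (\<lambda>x. g \<otimes> x)"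
proof -
  have c: "continuous_map T T (\<lambda>x. h \<otimes> x)" if "h \<in> carrier G" for h
    using that by (intro continuous_mult) (auto simp: continuous_map_id)
  show ?thesis
    using g by (intro homeomorphic_maps_imp_map[of _ _ _ "\<lambda>x. inv g \<otimes> x"])
      (auto simp: homeomorphic_maps_def c m_assoc[symmetric])
qed

lemma homeomorphic_inverse: "homeomorphic_map T T (\<lambda>x. inv x)"
  by (intro homeomorphic_maps_imp_map[of _ _ _ "\<lambda>x. inv x"])
    (auto simp: homeomorphic_maps_def continuous_inv)

text \<open>A translate is a preimage under the inverse translation, and preimages under continuous
  maps inherit Borel measurability.\<close>

lemma left_translate_vimage:
  assumes "g \<in> carrier G" "A \<subseteq> carrier G"
  shows "(\<lambda>x. g \<otimes> x) ` A = (\<lambda>x. inv g \<otimes> x) -` A \<inter> carrier G"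
proof -
  have "x \<in> (\<lambda>x. g \<otimes> x) ` A" if "inv g \<otimes> x \<in> A" "x \<in> carrier G" for x
    using that assms by (intro image_eqI[of _ _ "inv g \<otimes> x"]) (auto simp: m_assoc[symmetric])
  then show ?thesis using assms by (auto simp: m_assoc[symmetric] subset_iff)
qed

lemma borel_left_translate:
  assumes "g \<in> carrier G" "A \<in> borel_sets_of T"
  shows "(\<lambda>x. g \<otimes> x) ` A \<in> borel_sets_of T"
proof -
  have "A \<subseteq> carrier G"
    using borel_sets_of_subset[OF assms(2)] by simp
  moreover have "continuous_map T T (\<lambda>x. inv g \<otimes> x)"
    using assms by (intro continuous_mult) (auto simp: continuous_map_id)
  ultimately show ?thesis
    using borel_sets_of_vimage[OF _ assms(2), of T "\<lambda>x. inv g \<otimes> x"] assms by (simp add: left_translate_vimage)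
qed

text \<open>The continuous map sending \<open>(x, v, w)\<close> to
  \<open>x \<otimes> v \<otimes> inv w\<close> takes \<open>K \<times> {(\<one>, \<one>)}\<close>
  into \<open>U\<close>. Compactness of \<open>K\<close> and Wallace's theorem thicken this to a
  box. The shape \<open>K V V^{-1}\<close> arises because \<open>b\<close> lies in it whenever
  \<open>b V\<close> meets \<open>a V\<close> for some \<open>a\<close> in \<open>K\<close>.\<close>

lemma uniform_neighbourhood:
  assumes K: "closedin T K" and U: "openin T U" "K \<subseteq> U"
  shows "\<exists>V. openin T V \<and> \<one> \<in> V \<and> (\<forall>x\<in>K. \<forall>v\<in>V. \<forall>w\<in>V. x \<otimes> v \<otimes> inv w \<in> U)"
proof -
  let ?P = "prod_topology T (prod_topology T T)"
  let ?f = "\<lambda>p. fst p \<otimes> fst (snd p) \<otimes> inv (snd (snd p))"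
  have c: "continuous_map ?P T ?f"
    by (intro continuous_mult continuous_inv continuous_map_fst_of[unfolded comp_def] continuous_map_snd_of[unfolded comp_def]
        continuous_map_fst continuous_map_compose[OF continuous_map_snd continuous_map_fst, unfolded comp_def]
        continuous_map_compose[OF continuous_map_snd continuous_map_snd, unfolded comp_def])
  let ?W = "{p \<in> topspace ?P. ?f p \<in> U}"
  have W: "openin ?P ?W" using c U by (auto simp: continuous_map_def)
  have KG: "K \<subseteq> carrier G" using closedin_subset[OF K] by simp
  have sub: "K \<times> {(\<one>, \<one>)} \<subseteq> ?W" using KG U by (auto simp: subset_iff)
  obtain A B where AB: "openin T A" "openin (prod_topology T T) B" "K \<subseteq> A" "{(\<one>, \<one>)} \<subseteq> B" "A \<times> B \<subseteq> ?W"
    by (rule Wallace_theorem_prod_topology[OF _ _ W sub]) (use K in \<open>auto simp: compactin_iff_closedin\<close>)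
  then obtain V1 V2 where V: "openin T V1" "openin T V2" "\<one> \<in> V1" "\<one> \<in> V2" "V1 \<times> V2 \<subseteq> B"
    by (force simp: openin_prod_topology_alt)
  show ?thesis
  proof (intro exI[of _ "V1 \<inter> V2"] conjI ballI)
    fix x v w assume "x \<in> K" "v \<in> V1 \<inter> V2" "w \<in> V1 \<inter> V2"
    then have "(x, v, w) \<in> ?W" using AB V by blast
    then show "x \<otimes> v \<otimes> inv w \<in> U" by auto
  qed (use V in auto)
qed

text \<open>\<open>A\<close> is a smallest finite set whose translates \<open>a V\<close> cover the
  group, so \<open>g A\<close> and \<open>h A\<close> are smallest too. By the exchange, the points
  of \<open>g A\<close> in \<open>K\<close> are at most as many as the points \<open>h b\<close> for
  which \<open>h b V\<close> meets some \<open>g a V\<close> with \<open>g a\<close> in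
  \<open>K\<close>, and such \<open>h b\<close> lie in \<open>U\<close>. The net depends on
  \<open>V\<close> alone, so it serves all \<open>K\<close> and \<open>U\<close> at once.\<close>

lemma left_net:
  assumes V: "openin T V" "\<one> \<in> V"
  shows "\<exists>A. finite A \<and> A \<noteq> {} \<and> A \<subseteq> carrier G \<and>
    (\<forall>g\<in>carrier G. \<forall>h\<in>carrier G. \<forall>K U. (\<forall>x\<in>K. \<forall>v\<in>V. \<forall>w\<in>V. x \<otimes> v \<otimes> inv w \<in> U) \<longrightarrow>
      card {a \<in> A. g \<otimes> a \<in> K} \<le> card {a \<in> A. h \<otimes> a \<in> U})"
proof -
  define R where "R a = (\<lambda>x. a \<otimes> x) ` V" for a
  define cover where "cover C \<longleftrightarrow> finite C \<and> C \<subseteq> carrier G \<and> carrier G \<subseteq> \<Union>(R ` C)" for C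
  have VG: "V \<subseteq> carrier G" using openin_subset[OF V(1)] by simp
  have Ro: "openin T (R a)" if "a \<in> carrier G" for a
    unfolding R_def using homeomorphic_left_translation[OF that] V by (metis homeomorphic_map_openness openin_subset)
  have "compactin T (carrier G)" using cpt by (simp add: compact_space_def)
  moreover have "carrier G \<subseteq> \<Union>(R ` carrier G)"
    using V unfolding R_def by force
  ultimately obtain \<F> where F: "finite \<F>" "\<F> \<subseteq> R ` carrier G" "carrier G \<subseteq> \<Union>\<F>"
    using Ro unfolding compactin_def by (metis (no_types, lifting) image_iff)
  then obtain C0 where "cover C0"
    unfolding cover_def by (metis finite_subset_image)
  then obtain A where A: "cover A" and min: "\<And>C. cover C \<Longrightarrow> card A \<le> card C"
    using ex_has_least_nat[of cover C0 card] by blast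
  have fin: "finite A" and AG: "A \<subseteq> carrier G" and Ac: "carrier G \<subseteq> \<Union>(R ` A)"
    using A by (auto simp: cover_def)
  have trans: "cover ((\<lambda>a. g \<otimes> a) ` A)" if g: "g \<in> carrier G" for g
    unfolding cover_def
  proof (intro conjI subsetI)
    fix x assume x: "x \<in> carrier G"
    then have "inv g \<otimes> x \<in> \<Union>(R ` A)" using g Ac by (meson inv_closed m_closed subsetD)
    then obtain a v where av: "a \<in> A" "v \<in> V" "inv g \<otimes> x = a \<otimes> v" by (auto simp: R_def)
    then have G: "a \<in> carrier G" "v \<in> carrier G" using AG VG by auto
    then have "x = g \<otimes> (a \<otimes> v)" using av(3) x g by (subst (asm) inv_solve_left') auto
    then have "x = g \<otimes> a \<otimes> v" using x g G by (simp add: m_assoc)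
    then show "x \<in> \<Union> (R ` (\<otimes>) g ` A)" using av by (auto simp: R_def)
  qed (use fin AG g in auto)
  have cardtrans: "card ((\<lambda>a. g \<otimes> a) ` A \<inter> S) = card {a \<in> A. g \<otimes> a \<in> S}" if g: "g \<in> carrier G" for g S
  proof -
    have "(\<lambda>a. g \<otimes> a) ` A \<inter> S = (\<lambda>a. g \<otimes> a) ` {a \<in> A. g \<otimes> a \<in> S}" by auto
    moreover have "inj_on (\<lambda>a. g \<otimes> a) {a \<in> A. g \<otimes> a \<in> S}" using g AG by (auto simp: inj_on_def subset_iff)
    ultimately show ?thesis by (simp add: card_image)
  qed
  show ?thesis
  proof (intro exI[of _ A] conjI ballI allI impI fin AG)
    show "A \<noteq> {}" using Ac by auto
    fix g h K U assume g: "g \<in> carrier G" and h: "h \<in> carrier G"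
      and KU: "\<forall>x\<in>K. \<forall>v\<in>V. \<forall>w\<in>V. x \<otimes> v \<otimes> inv w \<in> U"
    let ?A = "(\<lambda>a. g \<otimes> a) ` A" and ?B = "(\<lambda>a. h \<otimes> a) ` A"
    have cA: "card ?A = card A" using cardtrans[OF g, of UNIV] by simp
    have "card (?A \<inter> K) \<le> card {b \<in> ?B. \<exists>a\<in>?A \<inter> K. R a \<inter> R b \<noteq> {}}"
    proof (rule minimal_cover_exchange[where \<Omega> = "carrier G"])
      show "carrier G \<subseteq> \<Union>(R ` ?A)" "carrier G \<subseteq> \<Union>(R ` ?B)" using trans[OF g] trans[OF h] unfolding cover_def by blast+
      show "\<Union>(R ` ?A) \<subseteq> carrier G" using AG VG g by (auto simp: R_def)
      fix C assume "finite C" "C \<subseteq> ?A \<union> ?B" "carrier G \<subseteq> \<Union>(R ` C)"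
      then have "cover C" using AG g h by (auto simp: cover_def)
      then show "card ?A \<le> card C" using min cA by simp
    qed (use fin in auto)
    also have "\<dots> \<le> card (?B \<inter> U)"
    proof (rule card_mono)
      show "{b \<in> ?B. \<exists>a\<in>?A \<inter> K. R a \<inter> R b \<noteq> {}} \<subseteq> ?B \<inter> U"
      proof
        fix y assume "y \<in> {b \<in> ?B. \<exists>a\<in>?A \<inter> K. R a \<inter> R b \<noteq> {}}"
        then obtain a b x where b: "b \<in> A" "y = h \<otimes> b" and a: "a \<in> A" "g \<otimes> a \<in> K"
          and x: "x \<in> R (g \<otimes> a)" "x \<in> R (h \<otimes> b)" by blast
        obtain v w where vw: "v \<in> V" "w \<in> V" "x = g \<otimes> a \<otimes> v" "x = h \<otimes> b \<otimes> w" using x by (auto simp: R_def)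
        have G: "a \<in> carrier G" "b \<in> carrier G" "v \<in> carrier G" "w \<in> carrier G" using a b vw AG VG by auto
        then have "h \<otimes> b = g \<otimes> a \<otimes> v \<otimes> inv w"
          using vw(3,4) g h by (subst inv_solve_right) auto
        then have "h \<otimes> b \<in> U" using KU a vw by auto
        then show "y \<in> ?B \<inter> U" using b by blast
      qed
    qed (use fin in auto)
    finally show "card {a \<in> A. g \<otimes> a \<in> K} \<le> card {a \<in> A. h \<otimes> a \<in> U}"
      using cardtrans g h by simp
  qed
qed

text \<open>Inversion exchanges the sides: \<open>inv a \<otimes> g\<close> is in \<open>S\<close>
  iff \<open>inv g \<otimes> a\<close> is in the inverse of \<open>S\<close>. Uniqueness needs this
  side, since the set of \<open>g\<close> with \<open>a \<otimes> g\<close> in \<open>S\<close> is a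
  left translate of \<open>S\<close>, to which left invariance applies.\<close>

lemma right_net:
  assumes K: "closedin T K" and U: "openin T U" "K \<subseteq> U"
  shows "\<exists>A. finite A \<and> A \<noteq> {} \<and> A \<subseteq> carrier G \<and>
    (\<forall>g\<in>carrier G. \<forall>h\<in>carrier G. card {a \<in> A. a \<otimes> g \<in> K} \<le> card {a \<in> A. a \<otimes> h \<in> U})"
proof -
  let ?i = "\<lambda>x. inv x"
  have KG: "K \<subseteq> carrier G" and UG: "U \<subseteq> carrier G" using closedin_subset[OF K] openin_subset[OF U(1)] by auto
  have "closedin T (?i ` K)" "openin T (?i ` U)"
    using homeomorphic_map_closedness[OF homeomorphic_inverse, of K] homeomorphic_map_openness[OF homeomorphic_inverse, of U]
      K U KG UG by auto
  then obtain V where V: "openin T V" "\<one> \<in> V" "\<forall>x\<in>?i ` K. \<forall>v\<in>V. \<forall>w\<in>V. x \<otimes> v \<otimes> inv w \<in> ?i ` U"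
    using uniform_neighbourhood[of "?i ` K" "?i ` U"] U by blast
  obtain A where A: "finite A" "A \<noteq> {}" "A \<subseteq> carrier G" and
    c: "\<forall>g\<in>carrier G. \<forall>h\<in>carrier G. \<forall>K U. (\<forall>x\<in>K. \<forall>v\<in>V. \<forall>w\<in>V. x \<otimes> v \<otimes> inv w \<in> U) \<longrightarrow>
      card {a \<in> A. g \<otimes> a \<in> K} \<le> card {a \<in> A. h \<otimes> a \<in> U}"
    using left_net[OF V(1,2)] by (elim exE conjE) (rule that)
  have eq: "card {a \<in> ?i ` A. a \<otimes> g \<in> S} = card {a \<in> A. inv g \<otimes> a \<in> ?i ` S}"
    if g: "g \<in> carrier G" and S: "S \<subseteq> carrier G" for g S
  proof -
    have "inv a \<otimes> g \<in> S \<longleftrightarrow> inv g \<otimes> a \<in> ?i ` S" if a: "a \<in> A" for a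
    proof -
      have aG: "a \<in> carrier G" using a A by auto
      have e: "inv (inv a \<otimes> g) = inv g \<otimes> a" using aG g by (simp add: inv_mult_group)
      show ?thesis
      proof
        assume "inv a \<otimes> g \<in> S" then show "inv g \<otimes> a \<in> ?i ` S" using e by (metis imageI)
      next
        assume "inv g \<otimes> a \<in> ?i ` S"
        then obtain s where "s \<in> S" "inv g \<otimes> a = inv s" by auto
        then show "inv a \<otimes> g \<in> S" using e aG g S by (metis inv_closed inv_inv m_closed subsetD)
      qed
    qed
    then have "{a \<in> ?i ` A. a \<otimes> g \<in> S} = ?i ` {a \<in> A. inv g \<otimes> a \<in> ?i ` S}" by auto
    moreover have "inj_on ?i {a \<in> A. inv g \<otimes> a \<in> ?i ` S}" using A by (auto simp: inj_on_def)
    ultimately show ?thesis by (simp add: card_image)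
  qed
  show ?thesis
  proof (intro exI[of _ "?i ` A"] conjI ballI)
    fix g h assume g: "g \<in> carrier G" and h: "h \<in> carrier G"
    show "card {a \<in> ?i ` A. a \<otimes> g \<in> K} \<le> card {a \<in> ?i ` A. a \<otimes> h \<in> U}"
      unfolding eq[OF g KG] eq[OF h UG] using g h V(3) by (intro c[rule_format]) auto
  qed (use A in auto)
qed

end

section \<open>Uniqueness of Haar measure\<close>

context compact_topological_group begin

lemma is_haarD:
  assumes "is_haar G T \<mu>"
  shows "emeasure \<mu> (carrier G) = 1" "space \<mu> = carrier G" "sets \<mu> = borel_sets_of T"
    "\<And>g A. g \<in> carrier G \<Longrightarrow> A \<in> borel_sets_of T \<Longrightarrow> emeasure \<mu> ((\<lambda>x. g \<otimes> x) ` A) = emeasure \<mu> A"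
    "\<And>A. A \<in> borel_sets_of T \<Longrightarrow> emeasure \<mu> A = (INF U\<in>{U. openin T U \<and> A \<subseteq> U}. emeasure \<mu> U)"
    "\<And>U. openin T U \<Longrightarrow> emeasure \<mu> U = (SUP K\<in>{K. closedin T K \<and> K \<subseteq> U}. emeasure \<mu> K)"
  using assms by (auto simp: is_haar_def compactin_iff_closedin)

text \<open>For a right net \<open>A\<close>, the number of \<open>a\<close> with
  \<open>a \<otimes> g\<close> in \<open>S\<close> integrates over \<open>g\<close> to
  \<open>card A\<close> times the measure of \<open>S\<close>, whichever Haar measure is used. The
  counts for \<open>K\<close> and \<open>U\<close> are separated by a constant, so the two measures
  are compared without a product measure. Outer regularity of \<nu> reduces the claim to open
  \<open>U\<close> around \<open>K\<close>.\<close>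

lemma haar_le_on_closed:
  assumes \<mu>: "is_haar G T \<mu>" and \<nu>: "is_haar G T \<nu>" and K: "closedin T K"
  shows "emeasure \<mu> K \<le> emeasure \<nu> K"
  unfolding is_haarD(5)[OF \<nu> borel_sets_of_closed[OF K]]
proof (rule INF_greatest, clarify)
  fix U assume U: "openin T U" "K \<subseteq> U"
  obtain A where A: "finite A" "A \<noteq> {}" "A \<subseteq> carrier G" and
    le: "\<forall>g\<in>carrier G. \<forall>h\<in>carrier G. card {a \<in> A. a \<otimes> g \<in> K} \<le> card {a \<in> A. a \<otimes> h \<in> U}"
    using right_net[OF K U] by (elim exE conjE) (rule that)
  define f where "f S g = card {a \<in> A. a \<otimes> g \<in> S}" for S g
  \<comment> \<open>The count is a finite sum of indicators of the translates of \<open>S\<close> by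
    \<open>inv a\<close>, each of measure \<open>emeasure M S\<close>.\<close>
  have int: "(\<integral>\<^sup>+g. of_nat (f S g) \<partial>M) = of_nat (card A) * emeasure M S"
    if M: "is_haar G T M" and S: "S \<in> borel_sets_of T" for M S
  proof -
    have SG: "S \<subseteq> carrier G" using borel_sets_of_subset[OF S] by simp
    have tr: "(\<lambda>x. inv a \<otimes> x) ` S \<in> borel_sets_of T" if "a \<in> A" for a
      using that A S by (intro borel_left_translate) auto
    have "(of_nat (f S g) :: ennreal) = (\<Sum>a\<in>A. indicator ((\<lambda>x. inv a \<otimes> x) ` S) g)" if g: "g \<in> carrier G" for g
    proof -
      have "(\<Sum>a\<in>A. indicator ((\<lambda>x. inv a \<otimes> x) ` S) g) = (\<Sum>a\<in>A. if a \<otimes> g \<in> S then 1 else (0::ennreal))"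
      proof (rule sum.cong[OF refl])
        fix a assume a: "a \<in> A"
        then have aG: "a \<in> carrier G" using A by auto
        have "g \<in> (\<lambda>x. inv a \<otimes> x) ` S \<longleftrightarrow> a \<otimes> g \<in> S"
          using left_translate_vimage[of "inv a" S] aG g SG by auto
        then show "indicator ((\<lambda>x. inv a \<otimes> x) ` S) g = (if a \<otimes> g \<in> S then 1 else (0::ennreal))"
          by (simp add: indicator_def)
      qed
      also have "\<dots> = of_nat (card {a \<in> A. a \<otimes> g \<in> S})"
        using A by (simp add: sum.If_cases Int_def)
      finally show ?thesis by (simp add: f_def)
    qed
    then have "(\<integral>\<^sup>+g. of_nat (f S g) \<partial>M) = (\<integral>\<^sup>+g. (\<Sum>a\<in>A. indicator ((\<lambda>x. inv a \<otimes> x) ` S) g) \<partial>M)"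
      by (intro nn_integral_cong) (simp add: is_haarD(2)[OF M])
    also have "\<dots> = (\<Sum>a\<in>A. (\<integral>\<^sup>+g. indicator ((\<lambda>x. inv a \<otimes> x) ` S) g \<partial>M))"
      using tr by (intro nn_integral_sum borel_measurable_indicator) (auto simp: is_haarD(3)[OF M])
    also have "\<dots> = (\<Sum>a\<in>A. emeasure M S)"
    proof (rule sum.cong[OF refl])
      fix a assume a: "a \<in> A"
      show "(\<integral>\<^sup>+g. indicator ((\<lambda>x. inv a \<otimes> x) ` S) g \<partial>M) = emeasure M S"
        using tr[OF a] a A is_haarD(4)[OF M _ S, of "inv a"]
        by (subst nn_integral_indicator) (auto simp: is_haarD(3)[OF M])
    qed
    finally show ?thesis by simp
  qed
  \<comment> \<open>\<open>f K \<le> c \<le> f U\<close> pointwise; integrate the left half against \<open>\<mu>\<close> and the right half against \<open>\<nu>\<close>.\<close>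
  define c where "c = Max (f K ` carrier G)"
  have fin: "finite (f K ` carrier G)"
    by (rule finite_subset[of _ "{..card A}"]) (auto simp: f_def A card_mono)
  have c1: "f K g \<le> c" if "g \<in> carrier G" for g
    using that fin by (auto simp: c_def)
  have c2: "c \<le> f U h" if "h \<in> carrier G" for h
    unfolding c_def using that fin le by (subst Max_le_iff) (auto simp: f_def)
  have "of_nat (card A) * emeasure \<mu> K = (\<integral>\<^sup>+g. of_nat (f K g) \<partial>\<mu>)"
    using int[OF \<mu> borel_sets_of_closed[OF K]] by simp
  also have "\<dots> \<le> (\<integral>\<^sup>+g. of_nat c \<partial>\<mu>)"
    using c1 by (intro nn_integral_mono) (auto simp: is_haarD(2)[OF \<mu>])
  also have "\<dots> = (\<integral>\<^sup>+g. of_nat c \<partial>\<nu>)"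
    by (simp add: is_haarD(1,2)[OF \<mu>] is_haarD(1,2)[OF \<nu>])
  also have "\<dots> \<le> (\<integral>\<^sup>+g. of_nat (f U g) \<partial>\<nu>)"
    using c2 by (intro nn_integral_mono) (auto simp: is_haarD(2)[OF \<nu>])
  also have "\<dots> = of_nat (card A) * emeasure \<nu> U"
    using int[OF \<nu> borel_sets_of_open[OF U(1)]] by simp
  finally have "of_nat (card A) * emeasure \<mu> K \<le> of_nat (card A) * emeasure \<nu> U" .
  then show "emeasure \<mu> K \<le> emeasure \<nu> U"
    using A by (subst (asm) ennreal_mult_le_mult_iff) auto
qed

text \<open>Agreement spreads from closed sets to open sets by inner regularity, then to Borel sets
  by outer regularity.\<close>

theorem haar_unique:
  assumes \<mu>: "is_haar G T \<mu>" and \<nu>: "is_haar G T \<nu>"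
  shows "\<mu> = \<nu>"
proof (rule measure_eqI)
  show "sets \<mu> = sets \<nu>" by (simp add: is_haarD(3)[OF \<mu>] is_haarD(3)[OF \<nu>])
  fix A assume "A \<in> sets \<mu>"
  then have A: "A \<in> borel_sets_of T" by (simp add: is_haarD(3)[OF \<mu>])
  have "emeasure \<mu> U = emeasure \<nu> U" if U: "openin T U" for U
    unfolding is_haarD(6)[OF \<mu> U] is_haarD(6)[OF \<nu> U]
    by (intro SUP_cong refl antisym haar_le_on_closed \<mu> \<nu>) auto
  then show "emeasure \<mu> A = emeasure \<nu> A"
    unfolding is_haarD(5)[OF \<mu> A] is_haarD(5)[OF \<nu> A] by (intro INF_cong) auto
qed

section \<open>Existence of Haar measure\<close>

text \<open>Counting in a net compares a translate of \<open>K\<close> only with a neighbourhood of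
  \<open>K\<close>, so invariance is stated with a gap between closed \<open>K\<close> and open
  \<open>U\<close>. Regularization closes the gap afterwards.\<close>

lemma invariant_finitely_additive_exists:
  "\<exists>l :: 'a set \<Rightarrow> real. (\<forall>A. 0 \<le> l A) \<and> l (carrier G) = 1 \<and>
     (\<forall>A B. A \<inter> B = {} \<longrightarrow> l (A \<union> B) = l A + l B) \<and>
     (\<forall>g K U. g \<in> carrier G \<longrightarrow> closedin T K \<longrightarrow> openin T U \<longrightarrow> K \<subseteq> U \<longrightarrow> l ((\<lambda>x. g \<otimes> x) ` K) \<le> l U)"
proof -
  define C :: "'a set \<Rightarrow> ('a set \<Rightarrow> real) set" where
    "C V = {l. (\<forall>A. 0 \<le> l A) \<and> l (carrier G) = 1 \<and> (\<forall>A B. A \<inter> B = {} \<longrightarrow> l (A \<union> B) = l A + l B) \<and>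
      (\<forall>g K U. g \<in> carrier G \<and> K \<subseteq> carrier G \<and> (\<forall>x\<in>K. \<forall>v\<in>V. \<forall>w\<in>V. x \<otimes> v \<otimes> inv w \<in> U) \<longrightarrow>
         l ((\<lambda>x. g \<otimes> x) ` K) \<le> l U)}" for V
  \<comment> \<open>The constraints for a neighbourhood \<open>V\<close> are satisfied by the counting measure of a minimal net; by compactness of
    \<open>[0,1]\<close>-valued set functions they can be satisfied for all \<open>V\<close> at once.\<close>
  let ?S = "PiE UNIV (\<lambda>_. {0..1}) :: ('a set \<Rightarrow> real) set"
  \<comment> \<open>A smaller \<open>V\<close> makes the premise on \<open>K\<close> and
    \<open>U\<close> easier to meet and so imposes more constraints. Hence \<open>C\<close> of a
    finite intersection of neighbourhoods lies in the intersection of their sets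
    \<open>C V\<close>.\<close>
  have anti: "C V \<subseteq> C V'" if "V \<subseteq> V'" for V V'
    using that unfolding C_def by (auto 0 3 simp: subset_iff)
  have ne: "?S \<inter> C V \<noteq> {}" if V: "openin T V" "\<one> \<in> V" for V
  proof -
    obtain A where A: "finite A" "A \<noteq> {}" "A \<subseteq> carrier G" and
      le: "\<forall>g\<in>carrier G. \<forall>h\<in>carrier G. \<forall>K U. (\<forall>x\<in>K. \<forall>v\<in>V. \<forall>w\<in>V. x \<otimes> v \<otimes> inv w \<in> U) \<longrightarrow>
      card {a \<in> A. g \<otimes> a \<in> K} \<le> card {a \<in> A. h \<otimes> a \<in> U}"
    using left_net[OF V] by (elim exE conjE) (rule that)
    define l where "l S = real (card (A \<inter> S)) / real (card A)" for S
    have cA: "card A > 0" using A by (simp add: card_gt_0_iff)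
    have "l \<in> ?S"
      using A cA card_mono[of A] by (auto simp: l_def divide_le_eq)
    moreover have "l \<in> C V"
      unfolding C_def
    proof (intro CollectI conjI allI impI)
      show "0 \<le> l S" for S by (simp add: l_def)
      show "l (carrier G) = 1" using A cA by (simp add: l_def Int_absorb2)
      show "l (S \<union> S') = l S + l S'" if "S \<inter> S' = {}" for S S'
      proof -
        have "card (A \<inter> (S \<union> S')) = card (A \<inter> S) + card (A \<inter> S')"
          unfolding Int_Un_distrib using that A by (intro card_Un_disjoint) auto
        then show ?thesis by (simp add: l_def add_divide_distrib)
      qed
      fix g K U assume *: "g \<in> carrier G \<and> K \<subseteq> carrier G \<and> (\<forall>x\<in>K. \<forall>v\<in>V. \<forall>w\<in>V. x \<otimes> v \<otimes> inv w \<in> U)"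
      \<comment> \<open>Translating \<open>K\<close> by \<open>g\<close> amounts to translating the
        net by \<open>inv g\<close>; it is compared with the untranslated net, written as
        translation by \<one>.\<close>
      have "A \<inter> (\<lambda>x. g \<otimes> x) ` K = {a \<in> A. inv g \<otimes> a \<in> K}"
        using * A left_translate_vimage[of g K] by auto
      moreover have "A \<inter> U = {a \<in> A. \<one> \<otimes> a \<in> U}" using A by auto
      ultimately have "card (A \<inter> (\<lambda>x. g \<otimes> x) ` K) \<le> card (A \<inter> U)"
        using le[rule_format, of "inv g" \<one> K U] * by simp
      then show "l ((\<lambda>x. g \<otimes> x) ` K) \<le> l U" by (simp add: l_def divide_right_mono)
    qed
    ultimately show ?thesis by blast
  qed
  \<comment> \<open>Each constraint is an equation or weak inequality in finitely many coordinates
    of \<open>l\<close>, hence closed in the product topology.\<close>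
  have closed: "closed (C V)" for V
  proof -
    have c: "continuous_on UNIV (\<lambda>l :: 'a set \<Rightarrow> real. l A)" for A
      by (rule continuous_on_product_coordinates)
    have "closed {l :: 'a set \<Rightarrow> real. A \<inter> B = {} \<longrightarrow> l (A \<union> B) = l A + l B}" for A B
      by (cases "A \<inter> B = {}") (auto intro!: closed_Collect_eq continuous_on_add c)
    moreover have "closed {l :: 'a set \<Rightarrow> real. g \<in> carrier G \<and> K \<subseteq> carrier G \<and> (\<forall>x\<in>K. \<forall>v\<in>V. \<forall>w\<in>V. x \<otimes> v \<otimes> inv w \<in> U) \<longrightarrow>
         l ((\<lambda>x. g \<otimes> x) ` K) \<le> l U}" for g K U
      by (intro closed_Collect_imp closed_Collect_le c open_Collect_const)
    ultimately show ?thesis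
      unfolding C_def by (intro closed_Collect_conj closed_Collect_all closed_Collect_le closed_Collect_eq c continuous_on_const)
  qed
  have "compactin (product_topology (\<lambda>_. euclideanreal) UNIV) ?S"
    by (subst compactin_PiE) simp
  then have cS: "compact ?S"
    by (simp add: euclidean_product_topology)
  have "?S \<inter> \<Inter>(C ` {V. openin T V \<and> \<one> \<in> V}) \<noteq> {}"
  proof (rule compact_imp_fip[OF cS])
    fix \<F> assume F: "finite \<F>" "\<F> \<subseteq> C ` {V. openin T V \<and> \<one> \<in> V}"
    then obtain \<V> where V: "finite \<V>" "\<V> \<subseteq> {V. openin T V \<and> \<one> \<in> V}" "\<F> = C ` \<V>"
      by (meson finite_subset_image)
    \<comment> \<open>The factor \<open>topspace T\<close> handles the empty family, whose
      intersection is the whole type.\<close>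
    have "openin T (topspace T \<inter> \<Inter>\<V>)" using V by (intro openin_Int_Inter) auto
    moreover have "\<one> \<in> topspace T \<inter> \<Inter>\<V>" using V by auto
    ultimately have "?S \<inter> C (topspace T \<inter> \<Inter>\<V>) \<noteq> {}" by (rule ne)
    moreover have "C (topspace T \<inter> \<Inter>\<V>) \<subseteq> \<Inter>\<F>"
      unfolding V(3) by (intro INT_greatest anti) auto
    ultimately show "?S \<inter> \<Inter>\<F> \<noteq> {}" by blast
  qed (use closed in auto)
  then obtain l where l: "\<And>V. openin T V \<Longrightarrow> \<one> \<in> V \<Longrightarrow> l \<in> C V" by auto
  have l0: "l \<in> C (carrier G)" using l[of "carrier G"] by simp
  have "l ((\<lambda>x. g \<otimes> x) ` K) \<le> l U"
    if g: "g \<in> carrier G" and K: "closedin T K" and U: "openin T U" "K \<subseteq> U" for g K U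
  proof -
    obtain V where "openin T V" "\<one> \<in> V" "\<forall>x\<in>K. \<forall>v\<in>V. \<forall>w\<in>V. x \<otimes> v \<otimes> inv w \<in> U"
      using uniform_neighbourhood[OF K U] by blast
    then show ?thesis using l[of V] g closedin_subset[OF K] by (auto simp: C_def)
  qed
  then show ?thesis using l0 by (intro exI[of _ l]) (auto simp: C_def)
qed

text \<open>Regularization makes the approximate invariance exact. A one-sided inequality is proved
  for open contents, then for outer contents; applying it to the inverse translation as well gives
  equality.\<close>

theorem haar_exists: "\<exists>\<mu>. is_haar G T \<mu>"
proof -
  obtain l :: "'a set \<Rightarrow> real" where pos: "\<And>A. 0 \<le> l A" and l1: "l (carrier G) = 1"
    and add: "\<And>A B. A \<inter> B = {} \<Longrightarrow> l (A \<union> B) = l A + l B"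
    and inv: "\<And>g K U. g \<in> carrier G \<Longrightarrow> closedin T K \<Longrightarrow> openin T U \<Longrightarrow> K \<subseteq> U \<Longrightarrow> l ((\<lambda>x. g \<otimes> x) ` K) \<le> l U"
    using invariant_finitely_additive_exists by blast
  interpret L: finitely_additive_compact T "\<lambda>A. ennreal (l A)"
  proof
    show "ennreal (l {}) = 0" using add[of "{}" "{}"] by simp
    show "ennreal (l (A \<union> B)) = ennreal (l A) + ennreal (l B)" if "A \<inter> B = {}" for A B
      using that pos by (simp add: add)
  qed (rule cpt haus)+
  have fin: "ennreal (l (topspace T)) < \<infinity>" by simp
  let ?\<mu> = "L.content_measure"
  have tr: "openin T ((\<lambda>x. g \<otimes> x) ` U) \<longleftrightarrow> openin T U" "closedin T ((\<lambda>x. g \<otimes> x) ` U) \<longleftrightarrow> closedin T U"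
    if "g \<in> carrier G" "U \<subseteq> carrier G" for g U
    using homeomorphic_map_openness[OF homeomorphic_left_translation] homeomorphic_map_closedness[OF homeomorphic_left_translation] that
    by auto
  have transl_inv: "(\<lambda>x. g \<otimes> x) ` (\<lambda>x. inv g \<otimes> x) ` U = U" if "g \<in> carrier G" "U \<subseteq> carrier G" for g U
  proof -
    have "g \<otimes> (inv g \<otimes> x) = x" if "x \<in> U" for x
      using that \<open>g \<in> carrier G\<close> \<open>U \<subseteq> carrier G\<close> by (subst m_assoc[symmetric]) auto
    then show ?thesis by (simp add: image_image)
  qed
  have oc: "L.open_content ((\<lambda>x. g \<otimes> x) ` U) \<le> L.open_content U" if g: "g \<in> carrier G" and U: "openin T U" for g U
    unfolding L.open_content_def[of "(\<lambda>x. g \<otimes> x) ` U"]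
  proof (rule SUP_least, clarify)
    fix K assume K: "closedin T K" "K \<subseteq> (\<lambda>x. g \<otimes> x) ` U"
    have KG: "K \<subseteq> carrier G" and UG: "U \<subseteq> carrier G" using closedin_subset[OF K(1)] openin_subset[OF U] by auto
    let ?K = "(\<lambda>x. inv g \<otimes> x) ` K"
    have K': "closedin T ?K" using tr(2)[of "inv g" K] g K KG by auto
    have KU: "?K \<subseteq> U" using image_mono[OF K(2), of "\<lambda>x. inv g \<otimes> x"] transl_inv[of "inv g" U] g UG by simp
    \<comment> \<open>Approximate invariance needs an open set around \<open>?K\<close>, while
      \<open>open_content U\<close> only sees closed sets inside \<open>U\<close>. Normality inserts
      \<open>W\<close> and its closure between the two.\<close>
    obtain W where W: "openin T W" "?K \<subseteq> W" "T closure_of W \<subseteq> U"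
      using L.normal_space_T[unfolded normal_space_alt, rule_format, OF conjI[OF K' conjI[OF U KU]]] by (elim exE conjE) (rule that)
    have "l K = l ((\<lambda>x. g \<otimes> x) ` ?K)" using transl_inv[OF g KG] by simp
    also have "\<dots> \<le> l W" using inv[OF g K' W(1,2)] .
    finally have "ennreal (l K) \<le> ennreal (l W)" by (rule ennreal_leI)
    also have "\<dots> \<le> ennreal (l (T closure_of W))"
      using openin_subset[OF W(1)] by (intro L.l_mono closure_of_subset) simp
    also have "\<dots> \<le> L.open_content U" using W by (intro L.open_content_upper) auto
    finally show "ennreal (l K) \<le> L.open_content U" .
  qed
  have om: "L.outer_content ((\<lambda>x. g \<otimes> x) ` A) \<le> L.outer_content A" if g: "g \<in> carrier G" for g A
    unfolding L.outer_content_def[of A]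
  proof (rule INF_greatest, clarify)
    fix U assume U: "openin T U" "A \<subseteq> U"
    have "L.outer_content ((\<lambda>x. g \<otimes> x) ` A) \<le> L.open_content ((\<lambda>x. g \<otimes> x) ` U)"
      using tr(1)[OF g, of U] U openin_subset[OF U(1)] by (intro L.outer_content_lower) auto
    also have "\<dots> \<le> L.open_content U" by (rule oc[OF g U(1)])
    finally show "L.outer_content ((\<lambda>x. g \<otimes> x) ` A) \<le> L.open_content U" .
  qed
  have "is_haar G T ?\<mu>"
    unfolding is_haar_def
  proof (intro conjI ballI allI impI)
    show "space ?\<mu> = topspace T" "sets ?\<mu> = borel_sets_of T"
      by (rule L.space_content_measure L.sets_content_measure)+
    have "L.open_content (topspace T) = 1"
    proof (rule antisym)
      show "L.open_content (topspace T) \<le> 1"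
        unfolding L.open_content_def using L.l_mono[of _ "carrier G"] by (intro SUP_least) (auto simp: l1)
      show "1 \<le> L.open_content (topspace T)"
        using L.open_content_upper[of "topspace T" "topspace T"] by (simp add: l1)
    qed
    then show "emeasure ?\<mu> (space ?\<mu>) = 1"
      by (simp add: L.space_content_measure[simplified] L.emeasure_content_measure[OF fin] borel_sets_of_open L.outer_content_open)
  next
    fix g A assume g: "g \<in> carrier G" and "A \<in> sets ?\<mu>"
    then have A: "A \<in> borel_sets_of T" by (simp add: L.sets_content_measure)
    have "L.outer_content A \<le> L.outer_content ((\<lambda>x. g \<otimes> x) ` A)"
      using om[of "inv g" "(\<lambda>x. g \<otimes> x) ` A"] transl_inv[of "inv g" A] g borel_sets_of_subset[OF A] by simp
    then show "emeasure ?\<mu> ((\<lambda>x. g \<otimes> x) ` A) = emeasure ?\<mu> A"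
      using om[OF g, of A] by (simp add: L.emeasure_content_measure[OF fin] A borel_left_translate[OF g A])
  next
    fix A assume "A \<in> sets ?\<mu>"
    then show "emeasure ?\<mu> A = (INF U\<in>{U. openin T U \<and> A \<subseteq> U}. emeasure ?\<mu> U)"
      by (intro L.content_measure_outer_regular[OF fin]) (simp add: L.sets_content_measure)
  next
    fix U assume "openin T U"
    then show "emeasure ?\<mu> U = (SUP K\<in>{K. compactin T K \<and> K \<subseteq> U}. emeasure ?\<mu> K)"
      by (rule L.content_measure_inner_regular[OF fin])
  qed
  then show ?thesis by blast
qed

lemma haar_measure_eqI: "is_haar G T \<mu> \<Longrightarrow> haar_measure G T = \<mu>"
  unfolding haar_measure_def using haar_unique by blast

lemma is_haar_haar_measure: "is_haar G T (haar_measure G T)"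
  using haar_exists haar_measure_eqI by metis

end

section \<open>Powers, quotients and images of compact groups\<close>

text \<open>\<open>comm_degree\<close> uses the Haar measure of the power group itself, not a
  product of measures on the factors; this result makes that Haar measure available.\<close>

lemma compact_group_product:
  fixes G (structure)
  assumes "compact_group G T"
  shows "compact_group (product_group I (\<lambda>_. G)) (product_topology (\<lambda>_. T) I)"
proof -
  interpret compact_topological_group G T using assms by unfold_locales
  let ?P = "product_topology (\<lambda>_. T) I"
  have p: "continuous_map (prod_topology ?P ?P) T (\<lambda>z. fst z i)" "continuous_map (prod_topology ?P ?P) T (\<lambda>z. snd z i)"
    if "i \<in> I" for i
    using continuous_map_compose[OF continuous_map_fst continuous_map_product_projection[where X = "\<lambda>_. T", OF that]]
      continuous_map_compose[OF continuous_map_snd continuous_map_product_projection[where X = "\<lambda>_. T", OF that]]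
    by (simp_all add: comp_def)
  have "continuous_map (prod_topology ?P ?P) ?P (\<lambda>z. \<lambda>i\<in>I. fst z i \<otimes> snd z i)"
    unfolding continuous_map_componentwise by (auto intro!: continuous_mult p)
  then have "continuous_map (prod_topology ?P ?P) ?P (\<lambda>(x, y). \<lambda>i\<in>I. x i \<otimes> y i)"
    by (simp add: case_prod_unfold)
  moreover have "continuous_map ?P ?P (\<lambda>x. inv\<^bsub>product_group I (\<lambda>_. G)\<^esub> x)"
  proof -
    have "continuous_map ?P ?P (\<lambda>x. \<lambda>i\<in>I. inv x i)"
      unfolding continuous_map_componentwise by (auto intro!: continuous_inv continuous_map_product_projection)
    then show ?thesis
      by (rule continuous_map_eq) (auto simp: is_group)
  qed
  ultimately show ?thesis
    unfolding compact_group_def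
    by (auto simp: is_group cpt haus compact_space_product_topology Hausdorff_space_product_topology)
qed

text \<open>Translations of \<open>H\<close> lift to translations of \<open>G\<close> by
  surjectivity. Both regularity properties transfer because \<phi>, a continuous map from a compact
  to a Hausdorff space, is closed.\<close>

lemma is_haar_distr:
  fixes H (structure)
  assumes G: "compact_group G T" and H: "compact_group H S"
    and \<phi>: "\<phi> \<in> hom G H" "\<phi> ` carrier G = carrier H" "continuous_map T S \<phi>"
    and \<mu>: "is_haar G T \<mu>"
  shows "is_haar H S (distr \<mu> (sigma (topspace S) (borel_sets_of S)) \<phi>)" (is "is_haar H S ?\<nu>")
proof -
  interpret G: compact_topological_group G T using G by unfold_locales
  interpret H: compact_topological_group H S using H by unfold_locales
  interpret h: group_hom G H \<phi> using \<phi> by unfold_locales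
  note m = G.is_haarD[OF \<mu>]
  have sp: "space ?\<nu> = carrier H"
    using borel_sets_of_subset[of _ S] by (auto simp: space_measure_of_conv)
  have se: "sets ?\<nu> = borel_sets_of S"
    by (simp only: sets_distr sigma_algebra.sets_measure_of_eq[OF sigma_algebra_borel_sets_of])
  have meas: "\<phi> \<in> measurable \<mu> (sigma (topspace S) (borel_sets_of S))"
    by (rule measurable_continuous_map[OF \<phi>(3)]) (simp_all add: m(2,3))
  have em: "emeasure ?\<nu> A = emeasure \<mu> (\<phi> -` A \<inter> carrier G)" if "A \<in> borel_sets_of S" for A
    using that se by (subst emeasure_distr[OF meas]) (auto simp: m(2))
  have vb: "\<phi> -` A \<inter> carrier G \<in> borel_sets_of T" if "A \<in> borel_sets_of S" for A
    using borel_sets_of_vimage[OF \<phi>(3) that] by simp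
  have clo: "closedin S (\<phi> ` K)" if "closedin T K" for K
    using image_compactin[OF _ \<phi>(3), of K] that by (simp add: G.compactin_iff_closedin H.compactin_iff_closedin)
  show ?thesis
    unfolding is_haar_def
  proof (intro conjI ballI allI impI)
    have "\<phi> -` carrier H \<inter> carrier G = carrier G" by auto
    then show "emeasure ?\<nu> (space ?\<nu>) = 1" unfolding sp using m(1) by (subst em) (auto intro: borel_sets_of_open)
    show "space ?\<nu> = topspace S" unfolding sp by simp
    show "sets ?\<nu> = borel_sets_of S" by (rule se)
  next
    fix b A assume b: "b \<in> carrier H" and "A \<in> sets ?\<nu>"
    then have A: "A \<in> borel_sets_of S" by (simp add: se del: sets_distr H.topspace_eq)
    have AH: "A \<subseteq> carrier H" using borel_sets_of_subset[OF A] by simp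
    obtain g where g: "g \<in> carrier G" "b = \<phi> g" using b \<phi>(2) by blast
    have "\<phi> -` ((\<lambda>x. b \<otimes> x) ` A) \<inter> carrier G = (\<lambda>x. g \<otimes>\<^bsub>G\<^esub> x) ` (\<phi> -` A \<inter> carrier G)"
      using g AH by (subst H.left_translate_vimage[OF b AH], subst G.left_translate_vimage) auto
    then show "emeasure ?\<nu> ((\<lambda>x. b \<otimes> x) ` A) = emeasure ?\<nu> A"
      using m(4)[OF g(1) vb[OF A]] by (simp add: em A H.borel_left_translate[OF b A] del: H.topspace_eq)
  next
    fix A assume "A \<in> sets ?\<nu>"
    then have A: "A \<in> borel_sets_of S" by (simp add: se del: sets_distr H.topspace_eq)
    show "emeasure ?\<nu> A = (INF U\<in>{U. openin S U \<and> A \<subseteq> U}. emeasure ?\<nu> U)"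
    proof (rule antisym)
      show "emeasure ?\<nu> A \<le> (INF U\<in>{U. openin S U \<and> A \<subseteq> U}. emeasure ?\<nu> U)"
        by (intro INF_greatest emeasure_mono) (auto simp: se borel_sets_of_open simp del: sets_distr H.topspace_eq)
      show "(INF U\<in>{U. openin S U \<and> A \<subseteq> U}. emeasure ?\<nu> U) \<le> emeasure ?\<nu> A"
        unfolding em[OF A] m(5)[OF vb[OF A]]
      proof (rule INF_mono, clarify)
        fix W assume W: "openin T W" "\<phi> -` A \<inter> carrier G \<subseteq> W"
        \<comment> \<open>This is the largest subset of \<open>H\<close> with preimage inside
          \<open>W\<close>; it is open because \<phi> is closed.\<close>
        let ?U = "carrier H - \<phi> ` (carrier G - W)"
        have U: "openin S ?U" using W by (intro openin_diff clo closedin_diff) auto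
        have AU: "A \<subseteq> ?U" using borel_sets_of_subset[OF A] W by auto
        have "emeasure ?\<nu> ?U \<le> emeasure \<mu> W"
          unfolding em[OF borel_sets_of_open[OF U]] using W
          by (intro emeasure_mono) (auto simp: m(3) borel_sets_of_open)
        then show "\<exists>U\<in>{U. openin S U \<and> A \<subseteq> U}. emeasure ?\<nu> U \<le> emeasure \<mu> W" using U AU by blast
      qed
    qed
  next
    fix U assume U: "openin S U"
    have oU: "openin T (\<phi> -` U \<inter> carrier G)"
    proof -
      have "openin T {x \<in> topspace T. \<phi> x \<in> U}" using \<phi>(3) U by (auto simp: continuous_map_def)
      also have "{x \<in> topspace T. \<phi> x \<in> U} = \<phi> -` U \<inter> carrier G" by auto
      finally show ?thesis .
    qed
    show "emeasure ?\<nu> U = (SUP K\<in>{K. compactin S K \<and> K \<subseteq> U}. emeasure ?\<nu> K)"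
    proof (rule antisym)
      show "(SUP K\<in>{K. compactin S K \<and> K \<subseteq> U}. emeasure ?\<nu> K) \<le> emeasure ?\<nu> U"
        using U by (intro SUP_least emeasure_mono) (auto simp: se borel_sets_of_open simp del: sets_distr H.topspace_eq)
      show "emeasure ?\<nu> U \<le> (SUP K\<in>{K. compactin S K \<and> K \<subseteq> U}. emeasure ?\<nu> K)"
        unfolding em[OF borel_sets_of_open[OF U]] m(6)[OF oU]
      proof (rule SUP_mono, clarify)
        fix K assume K: "closedin T K" "K \<subseteq> \<phi> -` U \<inter> carrier G"
        have "emeasure \<mu> K \<le> emeasure ?\<nu> (\<phi> ` K)"
          unfolding em[OF borel_sets_of_closed[OF clo[OF K(1)]]]
          using K vb[OF borel_sets_of_closed[OF clo[OF K(1)]]] by (intro emeasure_mono) (auto simp: m(3))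
        then show "\<exists>L\<in>{K. compactin S K \<and> K \<subseteq> U}. emeasure \<mu> K \<le> emeasure ?\<nu> L"
          using K clo by (intro bexI[of _ "\<phi> ` K"]) (auto simp: H.compactin_iff_closedin)
      qed
    qed
  qed
qed

section \<open>Quotients by closed normal subgroups\<close>

context compact_topological_group begin

context
  fixes N assumes N: "N \<lhd> G"
begin

interpretation normal N G by (rule N)

text \<open>This identifies \<open>quotient_top\<close>, defined through unions of cosets, with the
  usual quotient topology of the projection.\<close>

lemma Union_rcosets:
  assumes "\<U> \<subseteq> rcosets N"
  shows "\<Union>\<U> = {x \<in> carrier G. N #> x \<in> \<U>}"
proof (intro equalityI subsetI)
  fix x assume "x \<in> \<Union>\<U>"
  then obtain c where c: "c \<in> \<U>" "x \<in> c" by blast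
  then obtain y where y: "y \<in> carrier G" "c = N #> y" using assms by (auto simp: RCOSETS_def)
  then have "x \<in> carrier G" using c elemrcos_carrier[OF is_group] by blast
  moreover have "N #> x = c" using repr_independence[of x N y] c y subgroup_axioms by blast
  ultimately show "x \<in> {x \<in> carrier G. N #> x \<in> \<U>}" using c by blast
next
  fix x assume "x \<in> {x \<in> carrier G. N #> x \<in> \<U>}"
  then show "x \<in> \<Union>\<U>" using rcos_self[OF _ subgroup_axioms] by blast
qed

text \<open>The constructor \<open>topology\<close> can be unfolded only for a family satisfying
  \<open>istopology\<close>, which is verified here.\<close>

lemma openin_quotient_top:
  "openin (quotient_top G T N) \<U> \<longleftrightarrow> \<U> \<subseteq> rcosets N \<and> openin T {x \<in> carrier G. N #> x \<in> \<U>}"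
proof -
  let ?P = "\<lambda>\<U>. \<U> \<subseteq> rcosets N \<and> openin T {x \<in> carrier G. N #> x \<in> \<U>}"
  have eq: "(\<lambda>\<U>. \<U> \<subseteq> rcosets N \<and> openin T (\<Union>\<U>)) = ?P"
    using Union_rcosets by auto
  have "istopology ?P"
    unfolding istopology_def
  proof (intro conjI allI impI)
    fix A B assume A: "?P A" and B: "?P B"
    have "{x \<in> carrier G. N #> x \<in> A \<inter> B} = {x \<in> carrier G. N #> x \<in> A} \<inter> {x \<in> carrier G. N #> x \<in> B}" by auto
    then show "openin T {x \<in> carrier G. N #> x \<in> A \<inter> B}" using A B by auto
    show "A \<inter> B \<subseteq> rcosets N" using A by auto
  next
    fix \<K> assume K: "\<forall>K\<in>\<K>. ?P K"
    have "{x \<in> carrier G. N #> x \<in> \<Union>\<K>} = (\<Union>K\<in>\<K>. {x \<in> carrier G. N #> x \<in> K})" by auto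
    moreover have "openin T (\<Union>K\<in>\<K>. {x \<in> carrier G. N #> x \<in> K})" using K by (intro openin_Union) auto
    ultimately show "openin T {x \<in> carrier G. N #> x \<in> \<Union>\<K>}" by metis
    show "\<Union>\<K> \<subseteq> rcosets N" using K by auto
  qed
  then show ?thesis unfolding quotient_top_def eq by simp
qed

lemma rcosets_image: "rcosets N = (\<lambda>x. N #> x) ` carrier G"
  by (auto simp: RCOSETS_def)

lemma topspace_quotient_top: "topspace (quotient_top G T N) = rcosets N"
proof -
  have "{x \<in> carrier G. N #> x \<in> rcosets N} = carrier G" by (auto simp: rcosets_image)
  then have "openin (quotient_top G T N) (rcosets N)" unfolding openin_quotient_top by simp
  then show ?thesis
    unfolding topspace_def using openin_quotient_top by blast
qed

lemma continuous_quotient: "continuous_map T (quotient_top G T N) (\<lambda>x. N #> x)"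
  unfolding continuous_map_def by (auto simp: topspace_quotient_top rcosets_image openin_quotient_top)

text \<open>The saturation of \<open>U\<close> is \<open>N U\<close>, a union of left translates of
  \<open>U\<close>. This is why the projection is open.\<close>

lemma quotient_image_vimage:
  assumes "U \<subseteq> carrier G"
  shows "{x \<in> carrier G. N #> x \<in> (\<lambda>x. N #> x) ` U} = (\<Union>n\<in>N. (\<lambda>x. n \<otimes> x) ` U)"
proof (intro equalityI subsetI)
  fix x assume "x \<in> {x \<in> carrier G. N #> x \<in> (\<lambda>x. N #> x) ` U}"
  then obtain u where u: "u \<in> U" "x \<in> carrier G" "N #> x = N #> u" by auto
  then have "x \<in> N #> u" using rcos_self[of x N] subgroup_axioms by auto
  then show "x \<in> (\<Union>n\<in>N. (\<lambda>x. n \<otimes> x) ` U)" using u by (auto simp: r_coset_def)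
next
  fix x assume "x \<in> (\<Union>n\<in>N. (\<lambda>x. n \<otimes> x) ` U)"
  then obtain n u where nu: "n \<in> N" "u \<in> U" "x = n \<otimes> u" by auto
  then have "x \<in> N #> u" by (auto simp: r_coset_def)
  moreover have "u \<in> carrier G" using nu assms by auto
  ultimately have "N #> u = N #> x" using repr_independence subgroup_axioms by blast
  then show "x \<in> {x \<in> carrier G. N #> x \<in> (\<lambda>x. N #> x) ` U}" using nu assms by auto
qed

lemma openin_quotient_image:
  assumes U: "openin T U"
  shows "openin (quotient_top G T N) ((\<lambda>x. N #> x) ` U)"
proof -
  have UG: "U \<subseteq> carrier G" using openin_subset[OF U] by simp
  have "openin T ((\<lambda>x. n \<otimes> x) ` U)" if "n \<in> N" for n
    using homeomorphic_map_openness[OF homeomorphic_left_translation, of n U] that U UG by simp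
  then have "openin T (\<Union>n\<in>N. (\<lambda>x. n \<otimes> x) ` U)" by auto
  then show ?thesis
    unfolding openin_quotient_top quotient_image_vimage[OF UG] using UG by (auto simp: rcosets_image)
qed

text \<open>The Hausdorff property comes from closedness of \<open>N\<close>: for distinct cosets,
  \<open>x \<otimes> inv y\<close> lies in the open complement of \<open>N\<close>, and this
  persists on a box around \<open>(x, y)\<close>. Openness of the projection carries boxes down,
  both here and for continuity of multiplication. Inversion descends through the quotient
  map.\<close>

lemma compact_group_quotient:
  assumes cl: "closedin T N"
  shows "compact_group (G Mod N) (quotient_top G T N)"
proof -
  let ?Q = "quotient_top G T N" and ?p = "\<lambda>x. N #> x"
  have cQ: "carrier (G Mod N) = rcosets N" by (simp add: FactGroup_def)
  have quo: "quotient_map T ?Q ?p"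
    by (rule continuous_open_imp_quotient_map[OF continuous_quotient])
      (auto simp: open_map_def openin_quotient_image topspace_quotient_top rcosets_image)
  have "compactin ?Q (?p ` topspace T)"
    by (rule image_compactin[OF _ continuous_quotient]) (use cpt in \<open>simp add: compact_space_def\<close>)
  then have cs: "compact_space ?Q"
    by (simp add: compact_space_def topspace_quotient_top rcosets_image)
  have hs: "Hausdorff_space ?Q"
    unfolding Hausdorff_space_def topspace_quotient_top
  proof (intro allI impI)
    fix a b assume "a \<in> rcosets N \<and> b \<in> rcosets N \<and> a \<noteq> b"
    then obtain x y where xy: "x \<in> carrier G" "y \<in> carrier G" "a = ?p x" "b = ?p y" "a \<noteq> b"
      by (auto simp: rcosets_image)
    let ?P = "prod_topology T T"
    let ?f = "\<lambda>z. fst z \<otimes> inv (snd z)"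
    have "continuous_map ?P T ?f"
      by (intro continuous_mult continuous_inv continuous_map_fst continuous_map_snd)
    moreover have "openin T (carrier G - N)" using cl by auto
    ultimately have o: "openin ?P {z \<in> topspace ?P. ?f z \<in> carrier G - N}"
      by (auto simp: continuous_map_def)
    have key: "?p u \<noteq> ?p w \<longleftrightarrow> u \<otimes> inv w \<notin> N" if "u \<in> carrier G" "w \<in> carrier G" for u w
      using that repr_independence[of u N w] rcos_self[of u N] subgroup_axioms rcos_module[OF is_group, of w u] by auto
    have "(x, y) \<in> {z \<in> topspace ?P. ?f z \<in> carrier G - N}" using xy key[of x y] by auto
    then obtain U V where UV: "openin T U" "openin T V" "x \<in> U" "y \<in> V" "U \<times> V \<subseteq> {z \<in> topspace ?P. ?f z \<in> carrier G - N}"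
      using o unfolding openin_prod_topology_alt by meson
    have "disjnt (?p ` U) (?p ` V)"
    proof -
      have "?p u \<noteq> ?p w" if "u \<in> U" "w \<in> V" for u w
        using that UV(5) key[of u w] by auto
      then show ?thesis unfolding disjnt_def by blast
    qed
    then show "\<exists>U V. openin ?Q U \<and> openin ?Q V \<and> a \<in> U \<and> b \<in> V \<and> disjnt U V"
      using UV xy openin_quotient_image by (intro exI[of _ "?p ` U"] exI[of _ "?p ` V"]) auto
  qed
  have cm: "continuous_map (prod_topology ?Q ?Q) ?Q (\<lambda>(x, y). x \<otimes>\<^bsub>G Mod N\<^esub> y)"
    unfolding continuous_map_def
  proof (intro conjI allI impI)
    show "(\<lambda>(x, y). x \<otimes>\<^bsub>G Mod N\<^esub> y) \<in> topspace (prod_topology ?Q ?Q) \<rightarrow> topspace ?Q"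
      by (auto simp: topspace_quotient_top setmult_closed)
    fix \<U> assume U: "openin ?Q \<U>"
    show "openin (prod_topology ?Q ?Q) {z \<in> topspace (prod_topology ?Q ?Q). (case z of (x, y) \<Rightarrow> x \<otimes>\<^bsub>G Mod N\<^esub> y) \<in> \<U>}"
      unfolding openin_prod_topology_alt
    proof (intro allI impI)
      fix a b assume "(a, b) \<in> {z \<in> topspace (prod_topology ?Q ?Q). (case z of (x, y) \<Rightarrow> x \<otimes>\<^bsub>G Mod N\<^esub> y) \<in> \<U>}"
      then obtain x y where xy: "x \<in> carrier G" "y \<in> carrier G" "a = ?p x" "b = ?p y" "?p x <#> ?p y \<in> \<U>"
        by (auto simp: topspace_quotient_top rcosets_image)
      let ?W = "{z \<in> topspace (prod_topology T T). fst z \<otimes> snd z \<in> {x \<in> carrier G. ?p x \<in> \<U>}}"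
      have "continuous_map (prod_topology T T) T (\<lambda>z. fst z \<otimes> snd z)"
        by (intro continuous_mult continuous_map_fst continuous_map_snd)
      then have W: "openin (prod_topology T T) ?W"
        using U unfolding openin_quotient_top continuous_map_def by blast
      have "(x, y) \<in> ?W" using xy by (auto simp: rcos_sum)
      then obtain A B where AB: "openin T A" "openin T B" "x \<in> A" "y \<in> B" "A \<times> B \<subseteq> ?W"
        using W unfolding openin_prod_topology_alt by meson
      have "(?p ` A) \<times> (?p ` B) \<subseteq> {z \<in> topspace (prod_topology ?Q ?Q). (case z of (x, y) \<Rightarrow> x \<otimes>\<^bsub>G Mod N\<^esub> y) \<in> \<U>}"
      proof clarify
        fix s t assume "s \<in> A" "t \<in> B"
        then have "(s, t) \<in> ?W" using AB by blast
        then show "(?p s, ?p t) \<in> topspace (prod_topology ?Q ?Q) \<and> ?p s \<otimes>\<^bsub>G Mod N\<^esub> ?p t \<in> \<U>"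
          by (auto simp: topspace_quotient_top rcosets_image rcos_sum)
      qed
      then show "\<exists>U V. openin ?Q U \<and> openin ?Q V \<and> a \<in> U \<and> b \<in> V \<and>
          U \<times> V \<subseteq> {z \<in> topspace (prod_topology ?Q ?Q). (case z of (x, y) \<Rightarrow> x \<otimes>\<^bsub>G Mod N\<^esub> y) \<in> \<U>}"
        using AB xy openin_quotient_image by (intro exI[of _ "?p ` A"] exI[of _ "?p ` B"]) auto
    qed
  qed
  have "continuous_map T ?Q (\<lambda>x. ?p (inv x))"
    using continuous_map_compose[OF continuous_inv[OF continuous_map_id[unfolded id_def]] continuous_quotient] by (simp add: comp_def)
  then have "continuous_map T ?Q ((\<lambda>x. inv\<^bsub>G Mod N\<^esub> x) \<circ> ?p)"
    by (rule continuous_map_eq) (auto simp: inv_FactGroup rcos_inv cQ rcosets_image)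
  then have "continuous_map ?Q ?Q (\<lambda>x. inv\<^bsub>G Mod N\<^esub> x)"
    by (rule continuous_compose_quotient_map[OF quo])
  then show ?thesis
    unfolding compact_group_def using factorgroup_is_group cs hs cm by (simp add: topspace_quotient_top cQ)
qed

end

end

section \<open>The upper central series\<close>

lemma (in group) normal_group_center: "group_center G \<lhd> G"
proof (rule normal_invI)
  show "subgroup (group_center G) G"
  proof (rule subgroupI)
    show "inv a \<in> group_center G" if "a \<in> group_center G" for a
      unfolding group_center_def
    proof (clarsimp, intro conjI ballI)
      have a: "a \<in> carrier G" "\<And>y. y \<in> carrier G \<Longrightarrow> a \<otimes> y = y \<otimes> a" using that by (auto simp: group_center_def)
      show "inv a \<in> carrier G" using a by simp
      fix y assume y: "y \<in> carrier G"
      have "y = a \<otimes> (y \<otimes> inv a)" using a y by (simp add: m_assoc[symmetric]) (simp add: m_assoc)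
      then show "inv a \<otimes> y = y \<otimes> inv a" using a y by (subst inv_solve_left') auto
    qed
    show "a \<otimes> b \<in> group_center G" if "a \<in> group_center G" "b \<in> group_center G" for a b
    proof -
      have a: "a \<in> carrier G" "\<And>y. y \<in> carrier G \<Longrightarrow> a \<otimes> y = y \<otimes> a"
        and b: "b \<in> carrier G" "\<And>y. y \<in> carrier G \<Longrightarrow> b \<otimes> y = y \<otimes> b"
        using that by (auto simp: group_center_def)
      have "a \<otimes> b \<otimes> y = y \<otimes> (a \<otimes> b)" if y: "y \<in> carrier G" for y
      proof -
        have "a \<otimes> b \<otimes> y = a \<otimes> (y \<otimes> b)" using a(1) b y by (simp add: m_assoc)
        also have "\<dots> = (y \<otimes> a) \<otimes> b" using a b(1) y by (simp add: m_assoc[symmetric])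
        finally show ?thesis using a(1) b(1) y by (simp add: m_assoc)
      qed
      then show ?thesis using a(1) b(1) by (simp add: group_center_def)
    qed
  qed (auto simp: group_center_def)
  show "x \<otimes> h \<otimes> inv x \<in> group_center G" if "x \<in> carrier G" "h \<in> group_center G" for x h
  proof -
    have h: "h \<in> carrier G" "x \<otimes> h = h \<otimes> x" using that by (auto simp: group_center_def)
    then have "x \<otimes> h \<otimes> inv x = h" using that by (simp add: m_assoc)
    then show ?thesis using that by simp
  qed
qed

lemma (in group_hom) normal_vimage:
  assumes "N \<lhd> H"
  shows "{x \<in> carrier G. h x \<in> N} \<lhd> G"
proof -
  interpret N: normal N H by (rule assms)
  show ?thesis
  proof (rule G.normal_invI)
    show "subgroup {x \<in> carrier G. h x \<in> N} G"
      by (rule G.subgroupI) (auto intro: exI[of _ "\<one>\<^bsub>G\<^esub>"])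
  qed (auto intro: N.inv_op_closed2)
qed

context group begin

lemma commutator_eq_one_iff:
  assumes "x \<in> carrier G" "y \<in> carrier G"
  shows "commutator G x y = \<one> \<longleftrightarrow> x \<otimes> y = y \<otimes> x"
proof -
  have "commutator G x y = inv (y \<otimes> x) \<otimes> (x \<otimes> y)"
    using assms by (simp add: commutator_def inv_mult_group m_assoc)
  then show ?thesis using assms inv_solve_left'[of \<one> "y \<otimes> x" "x \<otimes> y"] by simp
qed

context
  fixes N assumes N: "N \<lhd> G"
begin

interpretation normal N G by (rule N)

lemma group_hom_quotient: "group_hom G (G Mod N) (\<lambda>x. N #> x)"
  using r_coset_hom_Mod factorgroup_is_group is_group by (simp add: group_hom_def group_hom_axioms_def)

lemma coset_eq_normal_iff: "x \<in> carrier G \<Longrightarrow> N #> x = N \<longleftrightarrow> x \<in> N"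
  using coset_join1 coset_join2 subgroup_axioms by blast

lemma commutator_quotient:
  assumes "x \<in> carrier G" "y \<in> carrier G"
  shows "commutator (G Mod N) (N #> x) (N #> y) = N #> commutator G x y"
proof -
  interpret h: group_hom G "G Mod N" "\<lambda>x. N #> x" by (rule group_hom_quotient)
  show ?thesis
    unfolding commutator_def using assms h.hom_mult h.hom_inv by simp
qed

end

end

text \<open>Trading commutators modulo \<open>N\<close> for commuting cosets spares later arguments
  all commutator identities.\<close>

lemma (in group) commutator_in_normal_iff:
  assumes N: "N \<lhd> G" and xy: "x \<in> carrier G" "y \<in> carrier G"
  shows "commutator G x y \<in> N \<longleftrightarrow> (N #> x) \<otimes>\<^bsub>G Mod N\<^esub> (N #> y) = (N #> y) \<otimes>\<^bsub>G Mod N\<^esub> (N #> x)"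
proof -
  interpret h: group_hom G "G Mod N" "\<lambda>x. N #> x" by (rule group_hom_quotient[OF N])
  have c: "commutator G x y \<in> carrier G" using xy by (simp add: commutator_def)
  show ?thesis
    using coset_eq_normal_iff[OF N c] commutator_quotient[OF N xy]
      h.H.commutator_eq_one_iff[of "N #> x" "N #> y"] xy h.hom_closed by simp
qed

text \<open>The elements commuting with \<open>a\<close> modulo \<open>N\<close> form a subgroup. It
  contains \<open>x\<close> and not \<open>g\<close>, hence not
  \<open>g \<otimes> x\<close>.\<close>

lemma (in group) commutator_mult_notin_normal:
  assumes N: "N \<lhd> G" and a: "a \<in> carrier G" and g: "g \<in> carrier G" and x: "x \<in> carrier G"
    and "commutator G a x \<in> N" "commutator G a g \<notin> N"
  shows "commutator G a (g \<otimes> x) \<notin> N"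
proof
  assume *: "commutator G a (g \<otimes> x) \<in> N"
  interpret h: group_hom G "G Mod N" "\<lambda>x. N #> x" by (rule group_hom_quotient[OF N])
  let ?p = "\<lambda>x. N #> x" and ?m = "mult (G Mod N)"
  have c: "?p a \<in> carrier (G Mod N)" "?p g \<in> carrier (G Mod N)" "?p x \<in> carrier (G Mod N)"
    using a g x h.hom_closed by auto
  have "?m (?m (?p a) (?p g)) (?p x) = ?m (?m (?p g) (?p a)) (?p x)"
    using * assms(5) a g x c unfolding commutator_in_normal_iff[OF N a x]
      commutator_in_normal_iff[OF N a m_closed[OF g x]] h.hom_mult[OF g x]
    by (metis h.H.m_assoc)
  then have "?m (?p a) (?p g) = ?m (?p g) (?p a)" using c by (metis h.H.m_closed h.H.r_cancel)
  then show False using assms(6) commutator_in_normal_iff[OF N a g] by simp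
qed

lemma (in group) normal_upper_central: "upper_central G i \<lhd> G"
proof (induction i)
  case 0 then show ?case by (simp add: one_is_normal)
next
  case (Suc i)
  interpret h: group_hom G "G Mod upper_central G i" "\<lambda>x. upper_central G i #> x"
    by (rule group_hom_quotient[OF Suc.IH])
  show ?case using h.normal_vimage[OF h.H.normal_group_center] by simp
qed

text \<open>Centrality modulo the previous term is rephrased by commutators, the form needed both
  for closedness and for the halving step.\<close>

lemma (in group) mem_upper_central_Suc:
  "x \<in> upper_central G (Suc i) \<longleftrightarrow> x \<in> carrier G \<and> (\<forall>y\<in>carrier G. commutator G x y \<in> upper_central G i)"
proof (cases "x \<in> carrier G")
  case True
  let ?N = "upper_central G i"
  interpret h: group_hom G "G Mod ?N" "\<lambda>x. ?N #> x"
    by (rule group_hom_quotient[OF normal_upper_central])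
  show ?thesis
    using True h.hom_closed commutator_in_normal_iff[OF normal_upper_central True]
    by (auto simp: group_center_def carrier_FactGroup simp del: mult_FactGroup)
qed auto

lemma iter_comm_cong: "(\<And>i. i \<le> k \<Longrightarrow> x i = y i) \<Longrightarrow> iter_comm G x k = iter_comm G y k"
  by (induction k) auto

context compact_topological_group begin

lemma continuous_commutator:
  assumes "continuous_map Y T f" "continuous_map Y T g"
  shows "continuous_map Y T (\<lambda>x. commutator G (f x) (g x))"
  unfolding commutator_def using assms by (intro continuous_mult continuous_inv)

lemma continuous_iter_comm:
  "k \<le> m \<Longrightarrow> continuous_map (product_topology (\<lambda>_. T) {..m}) T (\<lambda>x. iter_comm G x k)"
  by (induction k) (auto intro!: continuous_commutator continuous_map_product_projection)

text \<open>Each term is an intersection of preimages of the previous one under the continuous maps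
  \<open>x\<close> to \<open>[x, y]\<close>.\<close>

lemma closedin_upper_central: "closedin T (upper_central G i)"
proof (induction i)
  case 0
  have "closedin T {\<one>}" using haus by (simp add: closedin_Hausdorff_sing_eq)
  then show ?case by simp
next
  case (Suc i)
  have "closedin T (\<Inter>y\<in>carrier G. {x \<in> topspace T. commutator G x y \<in> upper_central G i})"
  proof (rule closedin_INT)
    show "carrier G \<noteq> {}" by auto
    fix y assume "y \<in> carrier G"
    then have "continuous_map T T (\<lambda>x. commutator G x y)"
      by (intro continuous_commutator) (auto simp: continuous_map_id[unfolded id_def])
    then show "closedin T {x \<in> topspace T. commutator G x y \<in> upper_central G i}"
      using Suc.IH by (rule closedin_continuous_map_preimage)
  qed
  also have "(\<Inter>y\<in>carrier G. {x \<in> topspace T. commutator G x y \<in> upper_central G i}) = upper_central G (Suc i)"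
    using mem_upper_central_Suc by (auto simp del: upper_central.simps)
  finally show ?case .
qed

section \<open>The halving estimate and its application to iterated commutators\<close>

text \<open>At least half of the union avoids \<open>F\<close>. For finite unions, split off the
  part \<open>?A\<close> of a new \<open>U t\<close> not yet covered: translation by
  \<open>h t\<close> preserves \<open>?A\<close> and moves \<open>?A \<inter> F\<close> into
  \<open>?A - F\<close>. These pieces are disjoint, so the estimates add up.\<close>

lemma haar_union_half:
  assumes \<mu>: "is_haar G T \<mu>" and F: "F \<in> borel_sets_of T"
    and h: "\<And>j. j \<in> J \<Longrightarrow> h j \<in> carrier G" and U: "\<And>j. j \<in> J \<Longrightarrow> openin T (U j)"
    and inv: "\<And>i j x. i \<in> J \<Longrightarrow> j \<in> J \<Longrightarrow> x \<in> carrier G \<Longrightarrow> h i \<otimes> x \<in> U j \<longleftrightarrow> x \<in> U j"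
    and move: "\<And>j x. j \<in> J \<Longrightarrow> x \<in> U j \<Longrightarrow> x \<in> F \<Longrightarrow> h j \<otimes> x \<notin> F"
  shows "emeasure \<mu> (\<Union>j\<in>J. U j) \<le> 2 * emeasure \<mu> ((\<Union>j\<in>J. U j) - F)"
proof -
  note m = is_haarD[OF \<mu>]
  have Fs: "F \<in> sets \<mu>" using F m by simp
  have Us: "U j \<in> sets \<mu>" if "j \<in> J" for j using U that m borel_sets_of_open by blast
  have UG: "U j \<subseteq> carrier G" if "j \<in> J" for j using openin_subset[OF U[OF that]] by simp
  have fin: "emeasure \<mu> (\<Union>j\<in>D. U j) \<le> 2 * emeasure \<mu> ((\<Union>j\<in>D. U j) - F)" if "finite D" "D \<subseteq> J" for D
    using that
  proof (induction D)
    case empty show ?case by simp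
  next
    case (insert t D)
    let ?V = "\<Union>j\<in>D. U j"
    let ?A = "U t - ?V"
    have t: "t \<in> J" and D: "D \<subseteq> J" using insert by auto
    have Vs: "?V \<in> sets \<mu>" using insert Us by auto
    have As: "?A \<in> sets \<mu>" using Vs Us[OF t] by auto
    have "emeasure \<mu> (?A \<inter> F) = emeasure \<mu> ((\<lambda>x. h t \<otimes> x) ` (?A \<inter> F))"
      using m(4)[OF h[OF t], of "?A \<inter> F"] sets.Int[OF As Fs] m(3) by simp
    \<comment> \<open>\<open>move\<close> takes the points out of \<open>F\<close>, while
      \<open>inv\<close> keeps them in \<open>U t\<close> and outside every earlier
      \<open>U j\<close>.\<close>
    also have "\<dots> \<le> emeasure \<mu> (?A - F)"
      using As Fs UG[OF t] D inv[OF t] move[OF t] t by (intro emeasure_mono) (auto simp: subset_iff)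
    finally have le: "emeasure \<mu> (?A \<inter> F) \<le> emeasure \<mu> (?A - F)" .
    have "emeasure \<mu> ?A = emeasure \<mu> (?A \<inter> F) + emeasure \<mu> (?A - F)"
      using As Fs by (subst plus_emeasure) (auto intro: arg_cong[where f = "emeasure \<mu>"])
    also have "\<dots> \<le> 2 * emeasure \<mu> (?A - F)" using le by (simp add: mult_2 add_right_mono)
    finally have A: "emeasure \<mu> ?A \<le> 2 * emeasure \<mu> (?A - F)" .
    have "emeasure \<mu> (\<Union>j\<in>insert t D. U j) = emeasure \<mu> (?A \<union> ?V)" by (rule arg_cong[where f = "emeasure \<mu>"]) auto
    also have "\<dots> = emeasure \<mu> ?A + emeasure \<mu> ?V" using As Vs by (subst plus_emeasure) auto
    also have "\<dots> \<le> 2 * emeasure \<mu> (?A - F) + 2 * emeasure \<mu> (?V - F)"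
      using A insert.IH D by (intro add_mono) auto
    also have "\<dots> = 2 * (emeasure \<mu> (?A - F) + emeasure \<mu> (?V - F))" by (simp add: distrib_left)
    also have "emeasure \<mu> (?A - F) + emeasure \<mu> (?V - F) = emeasure \<mu> ((?A - F) \<union> (?V - F))"
      using As Vs Fs by (intro plus_emeasure) auto
    also have "(?A - F) \<union> (?V - F) = (\<Union>j\<in>insert t D. U j) - F" by auto
    finally show ?case .
  qed
  have o: "openin T (\<Union>j\<in>J. U j)" using U by auto
  have Js: "(\<Union>j\<in>J. U j) \<in> sets \<mu>" using o m borel_sets_of_open by blast
  \<comment> \<open>\<open>J\<close> may be uncountable. Inner regularity of the open union reduces
    to compact subsets, each covered by finitely many \<open>U j\<close>.\<close>
  show ?thesis
    unfolding m(6)[OF o]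
  proof (rule SUP_least, clarify)
    fix K assume K: "closedin T K" "K \<subseteq> (\<Union>j\<in>J. U j)"
    have "compactin T K" using K by (simp add: compactin_iff_closedin)
    moreover have "\<forall>V\<in>U ` J. openin T V" using U by blast
    ultimately obtain \<F> where "finite \<F>" "\<F> \<subseteq> U ` J" "K \<subseteq> \<Union>\<F>"
      using K unfolding compactin_def by meson
    then obtain D where D: "D \<subseteq> J" "finite D" "K \<subseteq> (\<Union>j\<in>D. U j)"
      using finite_subset_image[of \<F> U J] by auto
    have Ds: "(\<Union>j\<in>D. U j) \<in> sets \<mu>" using D Us by auto
    have "emeasure \<mu> K \<le> emeasure \<mu> (\<Union>j\<in>D. U j)" using D Ds by (intro emeasure_mono)
    also have "\<dots> \<le> 2 * emeasure \<mu> ((\<Union>j\<in>D. U j) - F)" using fin D by simp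
    also have "\<dots> \<le> 2 * emeasure \<mu> ((\<Union>j\<in>J. U j) - F)"
      using Js Fs D by (intro mult_left_mono emeasure_mono) auto
    finally show "emeasure \<mu> K \<le> 2 * emeasure \<mu> ((\<Union>j\<in>J. U j) - F)" .
  qed
qed

end

section \<open>Commutativity degrees\<close>

context compact_topological_group begin

text \<open>The halving estimate is applied to translations of the single coordinate
  \<open>Suc k\<close>. Staying in one fixed power of \<open>G\<close> lets successive estimates be
  chained under the same \<mu>.\<close>

lemma iter_comm_notin_half:
  assumes \<mu>: "is_haar (product_group {..m} (\<lambda>_. G)) (product_topology (\<lambda>_. T) {..m}) \<mu>" and k: "Suc k \<le> m"
  shows "emeasure \<mu> {x \<in> (\<Pi>\<^sub>E i\<in>{..m}. carrier G). iter_comm G x k \<notin> upper_central G (Suc j)}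
    \<le> 2 * emeasure \<mu> {x \<in> (\<Pi>\<^sub>E i\<in>{..m}. carrier G). iter_comm G x (Suc k) \<notin> upper_central G j}"
proof -
  let ?P = "product_group {..m} (\<lambda>_. G)" and ?T = "product_topology (\<lambda>_. T) {..m}" and ?C = "\<Pi>\<^sub>E i\<in>{..m}. carrier G"
  interpret P: compact_topological_group ?P ?T
    using compact_group_product[OF compact_group] by unfold_locales
  note \<mu>D = P.is_haarD[OF \<mu>]
  have [simp]: "topspace ?T = ?C" by simp
  let ?Z = "upper_central G j"
  have cl: "iter_comm G x i \<in> carrier G" if "x \<in> ?C" "i \<le> m" for x i
    using continuous_iter_comm[OF that(2)] that(1) by (auto simp: continuous_map_def)
  define h where "h g = (\<lambda>i\<in>{..m}. if i = Suc k then g else \<one>)" for g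
  \<comment> \<open>\<open>U g\<close> depends only on the coordinates up to \<open>k\<close>, so
    every \<open>h g'\<close> leaves it invariant. It is open because \<open>?Z\<close> is
    closed.\<close>
  define U where "U g = {x \<in> ?C. commutator G (iter_comm G x k) g \<notin> ?Z}" for g
  define F where "F = {x \<in> ?C. iter_comm G x (Suc k) \<in> ?Z}"
  have hx: "mult ?P (h g) x = (\<lambda>i\<in>{..m}. if i = Suc k then g \<otimes> x i else x i)"
    if "g \<in> carrier G" "x \<in> ?C" for g x
    using that by (auto simp: h_def fun_eq_iff PiE_iff)
  have hx_C: "mult ?P (h g) x \<in> ?C" if "g \<in> carrier G" "x \<in> ?C" for g x
    unfolding hx[OF that] using that(1) PiE_mem[OF that(2)] by auto
  have hx_it: "iter_comm G (mult ?P (h g) x) k = iter_comm G x k" if "g \<in> carrier G" "x \<in> ?C" for g x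
    unfolding hx[OF that] using k by (intro iter_comm_cong) simp
  have closedF: "closedin ?T F"
    using closedin_continuous_map_preimage[OF continuous_iter_comm[OF k] closedin_upper_central] by (simp add: F_def)
  have openU: "openin ?T (U g)" if g: "g \<in> carrier G" for g
  proof -
    have "continuous_map ?T T (\<lambda>x. commutator G (iter_comm G x k) g)"
      using g k by (intro continuous_commutator continuous_iter_comm) auto
    then have "openin ?T {x \<in> topspace ?T. commutator G (iter_comm G x k) g \<in> topspace T - ?Z}"
      by (rule openin_continuous_map_preimage) (intro openin_diff openin_topspace closedin_upper_central)
    also have "{x \<in> topspace ?T. commutator G (iter_comm G x k) g \<in> topspace T - ?Z} = U g"
      using g k cl by (auto simp: U_def commutator_def)
    finally show ?thesis .
  qed
  \<comment> \<open>Failure to lie in the next central term is witnessed by some \<open>g\<close>;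
    the union runs over all possible witnesses.\<close>
  have eq: "{x \<in> ?C. iter_comm G x k \<notin> upper_central G (Suc j)} = (\<Union>g\<in>carrier G. U g)"
    unfolding mem_upper_central_Suc U_def using cl k by auto
  have "emeasure \<mu> (\<Union>g\<in>carrier G. U g) \<le> 2 * emeasure \<mu> ((\<Union>g\<in>carrier G. U g) - F)"
  proof (rule P.haar_union_half[OF \<mu>])
    show "F \<in> borel_sets_of ?T" using closedF by (rule borel_sets_of_closed)
    show "h g \<in> carrier ?P" if "g \<in> carrier G" for g using that by (auto simp: h_def)
    show "openin ?T (U g)" if "g \<in> carrier G" for g using that by (rule openU)
    show "mult ?P (h g) x \<in> U g' \<longleftrightarrow> x \<in> U g'" if "g \<in> carrier G" "g' \<in> carrier G" "x \<in> carrier ?P" for g g' x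
      using that hx_C[of g x] hx_it[of g x] by (simp add: U_def del: mult_product_group)
    show "mult ?P (h g) x \<notin> F" if g: "g \<in> carrier G" and "x \<in> U g" "x \<in> F" for g x
    proof -
      have x: "x \<in> ?C" "commutator G (iter_comm G x k) g \<notin> ?Z" "commutator G (iter_comm G x k) (x (Suc k)) \<in> ?Z"
        using that by (auto simp: U_def F_def)
      \<comment> \<open>Modulo \<open>?Z\<close>, the entry \<open>x (Suc k)\<close> commutes with
        the iterated commutator and \<open>g\<close> does not, so their product does not
        either.\<close>
      have "commutator G (iter_comm G x k) (g \<otimes> x (Suc k)) \<notin> ?Z"
        using x k g cl by (intro commutator_mult_notin_normal normal_upper_central) auto
      then have "iter_comm G (mult ?P (h g) x) (Suc k) \<notin> ?Z"
        using hx_it[OF g x(1)] hx[OF g x(1)] k by simp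
      then show ?thesis by (simp add: F_def del: mult_product_group iter_comm.simps)
    qed
  qed
  also have "\<dots> \<le> 2 * emeasure \<mu> (?C - F)"
    using closedF by (intro mult_left_mono emeasure_mono)
      (auto simp: U_def \<mu>D(3) intro!: borel_sets_of_open openin_diff P.openin_carrier[simplified])
  also have "?C - F = {x \<in> ?C. iter_comm G x (Suc k) \<notin> ?Z}" by (auto simp: F_def)
  finally show ?thesis unfolding eq .
qed

text \<open>The map \<phi> drops the coordinates beyond \<open>k\<close> and projects the others to
  \<open>G Mod N\<close>. It is a continuous epimorphism, so by uniqueness it pushes \<mu> to the
  Haar measure defining the degree. Allowing \<open>m\<close> larger than \<open>k\<close> expresses
  the degree in the same power of \<open>G\<close> as the halving estimates.\<close>

lemma comm_degree_quotient:
  assumes N: "N \<lhd> G" and cN: "closedin T N"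
    and \<mu>: "is_haar (product_group {..m} (\<lambda>_. G)) (product_topology (\<lambda>_. T) {..m}) \<mu>" and m: "k \<le> m"
  shows "comm_degree k (G Mod N) (quotient_top G T N) =
    measure \<mu> {x \<in> (\<Pi>\<^sub>E i\<in>{..m}. carrier G). iter_comm G x k \<in> N}"
proof -
  let ?P = "product_group {..m} (\<lambda>_. G)" and ?T = "product_topology (\<lambda>_. T) {..m}" and ?C = "\<Pi>\<^sub>E i\<in>{..m}. carrier G"
  let ?Q = "G Mod N" and ?S = "quotient_top G T N"
  let ?P2 = "product_group {..k} (\<lambda>_. ?Q)" and ?T2 = "product_topology (\<lambda>_. ?S) {..k}" and ?C2 = "\<Pi>\<^sub>E i\<in>{..k}. carrier ?Q"
  have cgP: "compact_group ?P ?T" by (rule compact_group_product[OF compact_group])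
  have cgQ: "compact_group ?Q ?S" by (rule compact_group_quotient[OF N cN])
  interpret P: compact_topological_group ?P ?T using cgP by unfold_locales
  interpret Q: compact_topological_group ?Q ?S using cgQ by unfold_locales
  have cgP2: "compact_group ?P2 ?T2" by (rule compact_group_product[OF cgQ])
  interpret P2: compact_topological_group ?P2 ?T2 using cgP2 by unfold_locales
  interpret h: group_hom G ?Q "\<lambda>x. N #> x" by (rule group_hom_quotient[OF N])
  note \<mu>D = P.is_haarD[OF \<mu>]
  define \<phi> where "\<phi> x = (\<lambda>i\<in>{..k}. N #> x i)" for x :: "nat \<Rightarrow> 'a"
  have hom: "\<phi> \<in> hom ?P ?P2"
    using m h.hom_closed h.hom_mult
    by (auto simp: hom_def \<phi>_def PiE_iff fun_eq_iff simp del: mult_FactGroup)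
  have surj: "\<phi> ` carrier ?P = carrier ?P2"
  proof (intro equalityI subsetI)
    fix y assume y: "y \<in> carrier ?P2"
    have "\<exists>a. a \<in> carrier G \<and> N #> a = y i" if "i \<le> k" for i
      using PiE_mem[of y "{..k}" "\<lambda>_. carrier ?Q" i] y that by (auto simp: carrier_FactGroup)
    then obtain f where f: "\<And>i. i \<le> k \<Longrightarrow> f i \<in> carrier G" "\<And>i. i \<le> k \<Longrightarrow> N #> f i = y i" by metis
    \<comment> \<open>The coordinates beyond \<open>k\<close> are forgotten by \<phi>, so any filler
      in \<open>G\<close> works.\<close>
    let ?x = "\<lambda>i\<in>{..m}. if i \<le> k then f i else \<one>"
    have "\<phi> ?x = y"
    proof
      fix i
      show "\<phi> ?x i = y i"
        using f(2)[of i] m y by (cases "i \<le> k") (auto simp: \<phi>_def PiE_iff extensional_def)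
    qed
    moreover have "?x \<in> carrier ?P" using f by auto
    ultimately show "y \<in> \<phi> ` carrier ?P" by blast
  qed (use hom in \<open>auto simp: hom_def simp del: carrier_product_group\<close>)
  have cont: "continuous_map ?T ?T2 \<phi>"
    unfolding continuous_map_componentwise
  proof (intro conjI ballI)
    show "\<phi> ` topspace ?T \<subseteq> extensional {..k}" by (auto simp: \<phi>_def)
    fix i assume i: "i \<in> {..k}"
    then have "continuous_map ?T T (\<lambda>x. x i)" using m by (intro continuous_map_product_projection) auto
    from continuous_map_compose[OF this continuous_quotient[OF N]] i
    show "continuous_map ?T ?S (\<lambda>x. \<phi> x i)" by (simp add: comp_def \<phi>_def)
  qed
  have haar: "haar_measure ?P2 ?T2 = distr \<mu> (sigma (topspace ?T2) (borel_sets_of ?T2)) \<phi>"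
    by (rule P2.haar_measure_eqI[OF is_haar_distr[OF cgP cgP2 hom surj cont \<mu>]])
  have it: "iter_comm ?Q (\<phi> x) i = N #> iter_comm G x i" if x: "x \<in> ?C" and "i \<le> k" for x i
    using that(2)
  proof (induction i)
    case 0 then show ?case by (simp add: \<phi>_def)
  next
    case (Suc i)
    have "iter_comm G x i \<in> carrier G" 
      using continuous_iter_comm[of i m] x Suc.prems m by (auto simp: continuous_map_def)
    moreover have "x (Suc i) \<in> carrier G" using x Suc.prems m by auto
    ultimately show ?case using Suc by (simp add: commutator_quotient[OF N] \<phi>_def)
  qed
  let ?E = "{y \<in> ?C2. iter_comm ?Q y k = \<one>\<^bsub>?Q\<^esub>}"
  have "closedin ?T2 {y \<in> topspace ?T2. iter_comm ?Q y k \<in> {\<one>\<^bsub>?Q\<^esub>}}"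
    by (rule closedin_continuous_map_preimage[OF Q.continuous_iter_comm])
      (use Q.haus in \<open>auto simp: closedin_Hausdorff_sing_eq simp del: one_FactGroup\<close>)
  then have "closedin ?T2 ?E" by simp
  then have E: "?E \<in> borel_sets_of ?T2" by (rule borel_sets_of_closed)
  have meas: "\<phi> \<in> measurable \<mu> (sigma (topspace ?T2) (borel_sets_of ?T2))"
    by (rule measurable_continuous_map[OF cont]) (simp_all add: \<mu>D(2,3))
  have "comm_degree k ?Q ?S = measure \<mu> (\<phi> -` ?E \<inter> space \<mu>)"
    unfolding comm_degree_def haar
    by (rule measure_distr[OF meas])
      (simp only: sigma_algebra.sets_measure_of_eq[OF sigma_algebra_borel_sets_of] E)
  also have "\<phi> -` ?E \<inter> space \<mu> = {x \<in> ?C. iter_comm G x k \<in> N}"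
  proof -
    have "\<phi> x \<in> ?C2" if "x \<in> ?C" for x using imageI[OF that, of \<phi>] surj by simp
    moreover have "iter_comm G x k \<in> carrier G" if "x \<in> ?C" for x
      using continuous_iter_comm[OF m] that by (auto simp: continuous_map_def)
    ultimately have "\<phi> x \<in> ?E \<longleftrightarrow> iter_comm G x k \<in> N" if "x \<in> ?C" for x
      using it[OF that order_refl] coset_eq_normal_iff[OF N] that by simp
    then show ?thesis unfolding \<mu>D(2) carrier_product_group by blast
  qed
  finally show ?thesis .
qed

end

theorem theorem3p4:
  fixes G :: "('a, 'b) monoid_scheme" and T :: "'a topology" and n :: nat
  assumes "compact_group G T" and "n \<ge> 1"
  shows "comm_degree (Suc n) G T
    \<le> (2 ^ n - 1 + comm_degree 1 (G Mod upper_central G n) (quotient_top G T (upper_central G n))) / 2 ^ n"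
proof -
  interpret compact_topological_group G T using assms(1) by unfold_locales
  let ?P = "product_group {..Suc n} (\<lambda>_. G)" and ?T = "product_topology (\<lambda>_. T) {..Suc n}"
    and ?C = "\<Pi>\<^sub>E i\<in>{..Suc n}. carrier G"
  interpret P: compact_topological_group ?P ?T
    using compact_group_product[OF assms(1)] by unfold_locales
  define \<mu> where "\<mu> = haar_measure ?P ?T"
  have \<mu>: "is_haar ?P ?T \<mu>" unfolding \<mu>_def by (rule P.is_haar_haar_measure)
  note \<mu>D = P.is_haarD[OF \<mu>]
  have space: "space \<mu> = ?C" and one: "emeasure \<mu> ?C = 1" using \<mu>D(1,2) by simp_all
  interpret finite_measure \<mu> by (rule finite_measureI) (simp add: space one)
  \<comment> \<open>The index is shifted by one from the overview: \<open>E k\<close> concerns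
    commutators of \<open>k + 2\<close> entries. At \<open>k = 0\<close> it tests membership of
    \<open>[x_0, x_1]\<close> in \<open>Z_n\<close>, giving the degree of the quotient; at
    \<open>k = n\<close> it tests membership in the trivial group, giving the degree of
    \<open>G\<close>.\<close>
  define E where "E k = {x \<in> ?C. iter_comm G x (Suc k) \<in> upper_central G (n - k)}" for k
  have E: "E k \<in> sets \<mu>" if "k \<le> n" for k
    using closedin_continuous_map_preimage[OF continuous_iter_comm closedin_upper_central, of "Suc k" "Suc n" "n - k"] that
    by (auto simp: E_def \<mu>D(3) intro: borel_sets_of_closed)
  have Ec: "measure \<mu> {x \<in> ?C. iter_comm G x (Suc k) \<notin> upper_central G (n - k)} = 1 - measure \<mu> (E k)" if "k \<le> n" for k
  proof -
    have "{x \<in> ?C. iter_comm G x (Suc k) \<notin> upper_central G (n - k)} = space \<mu> - E k"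
      by (auto simp: space E_def)
    then show ?thesis using finite_measure_compl[OF E[OF that]] one by (simp add: space measure_def)
  qed
  have step: "1 - measure \<mu> (E k) \<le> 2 * (1 - measure \<mu> (E (Suc k)))" if k: "k < n" for k
  proof -
    have nk: "n - k = Suc (n - Suc k)" using k by simp
    have "emeasure \<mu> {x \<in> ?C. iter_comm G x (Suc k) \<notin> upper_central G (n - k)}
      \<le> 2 * emeasure \<mu> {x \<in> ?C. iter_comm G x (Suc (Suc k)) \<notin> upper_central G (n - Suc k)}"
      unfolding nk using k by (intro iter_comm_notin_half[OF \<mu>]) auto
    then have "ennreal (measure \<mu> {x \<in> ?C. iter_comm G x (Suc k) \<notin> upper_central G (n - k)})
      \<le> ennreal (2 * measure \<mu> {x \<in> ?C. iter_comm G x (Suc (Suc k)) \<notin> upper_central G (n - Suc k)})"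
      by (simp add: emeasure_eq_measure ennreal_mult)
    then have "measure \<mu> {x \<in> ?C. iter_comm G x (Suc k) \<notin> upper_central G (n - k)}
      \<le> 2 * measure \<mu> {x \<in> ?C. iter_comm G x (Suc (Suc k)) \<notin> upper_central G (n - Suc k)}"
      by (subst (asm) ennreal_le_iff) auto
    then show ?thesis using Ec[of k] Ec[of "Suc k"] k by (simp del: iter_comm.simps)
  qed
  have "1 - measure \<mu> (E 0) \<le> 2 ^ k * (1 - measure \<mu> (E k))" if "k \<le> n" for k
    using that
  proof (induction k)
    case (Suc k)
    then have "1 - measure \<mu> (E 0) \<le> 2 ^ k * (1 - measure \<mu> (E k))" by simp
    also have "\<dots> \<le> 2 ^ k * (2 * (1 - measure \<mu> (E (Suc k))))"
      using step Suc.prems by (intro mult_left_mono) auto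
    finally show ?case by (simp add: algebra_simps)
  qed simp
  then have main: "1 - measure \<mu> (E 0) \<le> 2 ^ n * (1 - measure \<mu> (E n))" by simp
  have "measure \<mu> (E n) = comm_degree (Suc n) G T"
    by (simp add: comm_degree_def \<mu>_def E_def)
  moreover have "measure \<mu> (E 0) = comm_degree 1 (G Mod upper_central G n) (quotient_top G T (upper_central G n))"
    using comm_degree_quotient[OF normal_upper_central closedin_upper_central \<mu>, of 1 n] by (simp add: E_def)
  \<comment> \<open>Solving \<open>main\<close> for \<open>measure \<mu> (E n)\<close> gives
    \<open>1 - (1 - d) / 2^n\<close>, with \<open>d\<close> the degree of the quotient, which is the
    stated bound.\<close>
  ultimately show ?thesis using main by (simp add: field_simps)
qed

end
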